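(* For every even integer $k\ge 4$, the lower bound $\rho_k(\alpha)\ge\alpha^k$ for all $0<\alpha<1$ (conjectured by Gowers) is false; that is, for every even integer $k\ge 4$ there exists $\alpha\in(0,1)$ with $\rho_k(\alpha)<\alpha^k$.
   Context: $\rho_k(\alpha)$ denotes the minimum asymptotic density of $k$-term arithmetic progressions in a $U^{k-2}$-uniform set of density $\alpha$ (for $k=4$: in a Fourier-uniform set, which is equivalent to $U^2$-uniform), made precise as follows. For $A\subseteq\mathbb{Z}/N\mathbb{Z}$, its $k$-AP density is $\Lambda_k(A)=N^{-2}\,\#\{(x,d)\in(\mathbb{Z}/N\mathbb{Z})^2 : x,\,x+d,\,\ldots,\,x+(k-1)d\in A\}$. For $f:\mathbb{Z}/N\mathbb{Z}\to\mathbb{R}$ and $s\ge 2$, the Gowers norm is given by $\|f\|_{U^s}^{2^s}=N^{-(s+1)}\sum_{x,h_1,\ldots,h_s\in\mathbb{Z}/N\mathbb{Z}}\ \prod_{\omega\in\{0,1\}^s} f(x+\omega_1h_1+\cdots+\omega_sh_s)$. A sequence of sets $A_j\subseteq\mathbb{Z}/N_j\mathbb{Z}$, with $N_j\to\infty$ through primes, is $U^{s}$-uniform if $\|1_{A_j}-|A_j|/N_j\|_{U^s}\to 0$ as $j\to\infty$. For $0<\alpha<1$, $\rho_k(\alpha)$ is the infimum of $\liminf_{j\to\infty}\Lambda_k(A_j)$ over all $U^{k-2}$-uniform sequences $(A_j)$ with $|A_j|/N_j\to\alpha$. *)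

theory Defs
  imports Complex_Main "HOL-Library.FuncSet" "HOL-Library.Indicator_Function" "HOL-Library.Liminf_Limsup"
    "HOL-Library.Extended_Real" "HOL-Computational_Algebra.Primes"
begin

text \<open>The group of residues modulo \<open>N\<close> is represented by \<open>{..<N}\<close>, with sums reduced by
  \<open>mod N\<close>. Thus a subset of the group is a set \<open>A \<subseteq> {..<N}\<close>, and only the values of a
  function on \<open>{..<N}\<close> matter.\<close>

definition ap_density :: "nat \<Rightarrow> nat \<Rightarrow> nat set \<Rightarrow> real" where
  "ap_density k N A =
     real (card {(x, d). x < N \<and> d < N \<and> (\<forall>i<k. (x + i * d) mod N \<in> A)}) / real N ^ 2"

text \<open>The average below is nonnegative for \<open>s \<ge> 1\<close>, so that the root is the genuine one.\<close>

definition gowers_norm :: "nat \<Rightarrow> nat \<Rightarrow> (nat \<Rightarrow> real) \<Rightarrow> real" where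
  "gowers_norm s N f =
     root (2 ^ s)
       ((\<Sum>x<N. \<Sum>h\<in>{..<s} \<rightarrow>\<^sub>E {..<N}.
           \<Prod>\<omega>\<in>{..<s} \<rightarrow>\<^sub>E {0, 1}. f ((x + (\<Sum>i<s. \<omega> i * h i)) mod N))
        / real N ^ (s + 1))"

definition uniform_sequence :: "nat \<Rightarrow> (nat \<Rightarrow> nat) \<Rightarrow> (nat \<Rightarrow> nat set) \<Rightarrow> bool" where
  "uniform_sequence s N A \<longleftrightarrow>
     (\<forall>j. prime (N j)) \<and> filterlim N at_top sequentially \<and>
     (\<forall>j. A j \<subseteq> {..<N j}) \<and>
     (\<lambda>j. gowers_norm s (N j)
        (\<lambda>x. indicator (A j) x - real (card (A j)) / real (N j))) \<longlonglongrightarrow> 0"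

text \<open>The infimum is taken in the extended reals, to have it and the inferior limits in a
  complete lattice.\<close>

definition rho :: "nat \<Rightarrow> real \<Rightarrow> ereal" where
  "rho k \<alpha> =
     Inf {liminf (\<lambda>j. ereal (ap_density k (N j) (A j))) | N A.
            uniform_sequence (k - 2) N A \<and>
            (\<lambda>j. real (card (A j)) / real (N j)) \<longlonglongrightarrow> \<alpha>}"

end

theory Submission
  imports Defs "HOL-Analysis.Analysis" "HOL-Library.Real_Mod" "HOL-Number_Theory.Cong"
begin

text \<open>Let \<open>s = k - 2\<close>. The values of a polynomial of degree \<open>s\<close> along a \<open>k\<close>-term progression satisfy,
  up to scaling, a single linear relation, with coefficients \<open>(-1)^i (k - 1 choose i)\<close>. Perturb the
  constant \<open>1/2\<close> by small multiples \<open>\<plusminus>\<epsilon>\<close> of phases \<open>a x^s + b x\<close> modulo \<open>N\<close> with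
  \<open>a = \<plusminus>(k - 1 choose i)\<close>. By Weyl differencing, the perturbation is small in the \<open>U^s\<close> norm, and
  its progression density tends to \<open>1/2^k\<close> plus the contributions of those \<open>k\<close>-tuples of phases that
  cancel along every progression. With \<open>b = 0\<close> and \<open>k\<close> even such contributions are always nonnegative,
  because the coefficients of the relation come in opposite pairs. The linear terms break this
  positivity: they can be chosen, with one negative weight, so that each nonconstant cancelling tuple
  contributes \<open>-\<epsilon>^k\<close>. The function is then replaced by a set, and \<open>\<alpha> = 1/2\<close>.\<close>

section \<open>Exponentials and cubes modulo N\<close>

text \<open>Phases of degree \<open>k - 2\<close> are the borderline case: their
  \<open>U^(k-2)\<close> norm tends to zero, yet progressions of length \<open>k\<close> detect
  them. If the leading coefficient alone determined the frequency, positions \<open>i\<close> and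
  \<open>k - 1 - i\<close> of a cancelling tuple would carry opposite phases. The coefficients of a
  real function at opposite phases are conjugate, so every tuple would contribute a product of
  squares. The leading coefficients \<open>1\<close> and \<open>k - 1\<close> are therefore offered
  with two linear terms each, and all others with none. These terms are such that cancellation never
  allows opposite frequencies at the positions \<open>1\<close> and \<open>k - 2\<close>. Each of
  these two positions has one option of weight \<open>\<epsilon>\<close> and one of weight
  \<open>- \<epsilon>\<close>, so exactly one negative sign occurs. As all nonconstant tuples then
  pull in the same direction, a single one yields the strict inequality.\<close>

definition e_mod :: "nat \<Rightarrow> int \<Rightarrow> complex" where
  "e_mod N n = cis (2 * pi * real_of_int n / real N)"

lemma norm_e_mod [simp]: "cmod (e_mod N n) = 1"
  by (simp add: e_mod_def)

lemma e_mod_0 [simp]: "e_mod N 0 = 1"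
  by (simp add: e_mod_def)

lemma e_mod_add: "e_mod N (m + n) = e_mod N m * e_mod N n"
  by (simp add: e_mod_def cis_mult add_divide_distrib distrib_left)

lemma cnj_e_mod: "cnj (e_mod N n) = e_mod N (- n)"
  by (simp add: e_mod_def cis_cnj)

lemma e_mod_diff: "e_mod N (m - n) = e_mod N m * cnj (e_mod N n)"
  using e_mod_add[of N m "- n"] by (simp add: cnj_e_mod)

lemma e_mod_sum: "e_mod N (\<Sum>i\<in>I. f i) = (\<Prod>i\<in>I. e_mod N (f i))"
  by (induction I rule: infinite_finite_induct) (auto simp: e_mod_add)

lemma e_mod_eq_1_iff:
  assumes "N > 0"
  shows "e_mod N n = 1 \<longleftrightarrow> int N dvd n"
proof -
  have "e_mod N n = 1 \<longleftrightarrow> (\<exists>m. real_of_int n = real_of_int (int N * m))"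
    using assms by (auto simp: e_mod_def cis_eq_1_iff field_simps)
  also have "\<dots> \<longleftrightarrow> int N dvd n"
    unfolding of_int_eq_iff by (auto simp: dvd_def)
  finally show ?thesis .
qed

lemma e_mod_cong:
  assumes "N > 0" "int N dvd m - n"
  shows "e_mod N m = e_mod N n"
  using e_mod_add[of N n "m - n"] e_mod_eq_1_iff[OF assms(1), of "m - n"] assms(2) by simp

lemma sum_shift_periodic:
  fixes F :: "nat \<Rightarrow> 'a::ab_group_add"
  assumes "\<And>x. F (x + N) = F x"
  shows "(\<Sum>x<N. F (x + t)) = (\<Sum>x<N. F x)"
proof (induction t)
  case (Suc t)
  have "(\<Sum>x<N. F (Suc x + t)) + F t = (\<Sum>x<N. F (x + t)) + F (N + t)"
    using sum.lessThan_Suc_shift[of "\<lambda>x. F (x + t)" N] sum.lessThan_Suc[of "\<lambda>x. F (x + t)" N]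
    by (simp add: add.commute)
  then show ?case
    using Suc assms[of t] by (simp add: add.commute)
qed simp

lemma sum_mult_shift:
  fixes F G :: "nat \<Rightarrow> 'a::comm_ring"
  assumes "\<And>x. G (x + N) = G x"
  shows "(\<Sum>t<N. \<Sum>x<N. F x * G (x + t)) = (\<Sum>x<N. F x) * (\<Sum>x<N. G x)"
proof -
  have "(\<Sum>t<N. \<Sum>x<N. F x * G (x + t)) = (\<Sum>x<N. F x * (\<Sum>t<N. G (t + x)))"
    by (subst sum.swap) (simp add: sum_distrib_left add.commute)
  then show ?thesis
    using sum_shift_periodic[of G N] assms by (simp add: sum_distrib_right)
qed

text \<open>The shift \<open>x -> x + 1\<close> preserves the sum and also multiplies it by
  \<open>e_mod N a\<close>, which is not 1.\<close>

lemma sum_e_mod_linear: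
  assumes "N > 0" "\<not> int N dvd a"
  shows "(\<Sum>x<N. e_mod N (a * int x + b)) = 0"
proof -
  define F where "F = (\<lambda>x. e_mod N (a * int x + b))"
  have "F (x + N) = F x" for x
    unfolding F_def by (rule e_mod_cong) (use assms in \<open>auto simp: algebra_simps\<close>)
  then have "(\<Sum>x<N. F (x + 1)) = (\<Sum>x<N. F x)"
    by (rule sum_shift_periodic)
  moreover have "F (x + 1) = e_mod N a * F x" for x
    by (simp add: F_def algebra_simps flip: e_mod_add)
  ultimately have "(e_mod N a - 1) * (\<Sum>x<N. F x) = 0"
    by (simp add: sum_distrib_left algebra_simps)
  then show ?thesis
    using e_mod_eq_1_iff[OF assms(1)] assms(2) by (simp add: F_def)
qed

lemma PiE_lessThan_Suc_bij:
  "bij_betw (\<lambda>(h, b). h(s := b)) (({..<s} \<rightarrow>\<^sub>E B) \<times> B) ({..<Suc s} \<rightarrow>\<^sub>E B)"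
proof -
  have "inj_on (\<lambda>(h, b). h(s := b)) (({..<s} \<rightarrow>\<^sub>E B) \<times> B)"
  proof (rule inj_onI, clarify)
    fix h b h' b'
    assume h: "h \<in> {..<s} \<rightarrow>\<^sub>E B" "h' \<in> {..<s} \<rightarrow>\<^sub>E B" and eq: "h(s := b) = h'(s := b')"
    have "h i = h' i" for i
      using h fun_cong[OF eq, of i] by (cases "i = s") (auto simp: PiE_def extensional_def)
    then show "h = h' \<and> b = b'"
      using fun_cong[OF eq, of s] by auto
  qed
  moreover have "(\<lambda>(h, b). h(s := b)) ` (({..<s} \<rightarrow>\<^sub>E B) \<times> B) = {..<Suc s} \<rightarrow>\<^sub>E B"
    unfolding lessThan_Suc PiE_insert_eq by (force simp: image_iff)
  ultimately show ?thesis
    by (simp add: bij_betw_def)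
qed

lemma sum_PiE_lessThan_Suc:
  "(\<Sum>h\<in>{..<Suc s} \<rightarrow>\<^sub>E B. F h) = (\<Sum>h\<in>{..<s} \<rightarrow>\<^sub>E B. \<Sum>b\<in>B. F (h(s := b)))"
  using sum.reindex_bij_betw[OF PiE_lessThan_Suc_bij, of F s B]
  by (simp add: sum.cartesian_product case_prod_unfold)

lemma prod_PiE_lessThan_Suc:
  "(\<Prod>h\<in>{..<Suc s} \<rightarrow>\<^sub>E B. F h) = (\<Prod>h\<in>{..<s} \<rightarrow>\<^sub>E B. \<Prod>b\<in>B. F (h(s := b)))"
  using prod.reindex_bij_betw[OF PiE_lessThan_Suc_bij, of F s B]
  by (simp add: prod.cartesian_product case_prod_unfold)

text \<open>The product of \<open>\<phi> x\<close> with the values of \<open>g\<close> at the other vertices of the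
  \<open>s\<close>-dimensional cube with base point \<open>x\<close> and edges \<open>h\<close>. Keeping one vertex separate makes the
  Gowers average linear in that vertex.\<close>

fun cube :: "nat \<Rightarrow> (nat \<Rightarrow> 'a::comm_monoid_mult) \<Rightarrow> (nat \<Rightarrow> 'a) \<Rightarrow> (nat \<Rightarrow> nat) \<Rightarrow> nat \<Rightarrow> 'a" where
  "cube 0 \<phi> g h x = \<phi> x"
| "cube (Suc s) \<phi> g h x = cube s \<phi> g h x * cube s g g h (x + h s)"

lemma cube_cong: "(\<And>i. i < s \<Longrightarrow> h i = h' i) \<Longrightarrow> cube s \<phi> g h x = cube s \<phi> g h' x"
  by (induction s arbitrary: \<phi> x) auto

lemma cube_upd [simp]: "cube s \<phi> g (h(s := b)) x = cube s \<phi> g h x"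
  by (rule cube_cong) auto

lemma cube_periodic:
  assumes "\<And>x. \<phi> (x + N) = \<phi> x" "\<And>x. g (x + N) = g x"
  shows "cube s \<phi> g h (x + N) = cube s \<phi> g h x"
  using assms
proof (induction s arbitrary: \<phi> x)
  case (Suc s)
  have "cube s g g h (x + N + h s) = cube s g g h (x + h s)"
    using Suc.IH[of g "x + h s"] Suc.prems by (simp add: add.assoc add.commute[of N])
  then show ?case
    using Suc by simp
qed simp

text \<open>With \<open>cube_shift\<close> and \<open>cube_cnj\<close>, this turns the
  multiplicative derivative of a cube product into the cube product of the derivatives, which is the
  differencing step for Weyl sums.\<close>

lemma cube_mult:
  "cube s (\<lambda>x. \<phi> x * \<phi>' x) (\<lambda>x. g x * g' x) h x = cube s \<phi> g h x * cube s \<phi>' g' h x"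
  by (induction s arbitrary: \<phi> \<phi>' x) (auto simp: mult_ac)

lemma cube_shift: "cube s (\<lambda>x. \<phi> (x + t)) (\<lambda>x. g (x + t)) h x = cube s \<phi> g h (x + t)"
  by (induction s arbitrary: \<phi> x) (auto simp: add_ac)

lemma cube_cnj: "cube s (\<lambda>x. cnj (\<phi> x)) (\<lambda>x. cnj (g x)) h x = cnj (cube s \<phi> g h x)"
  by (induction s arbitrary: \<phi> x) auto

lemma cube_of_real:
  "cube s (\<lambda>x. of_real (\<phi> x)) (\<lambda>x. of_real (g x)) h x = complex_of_real (cube s \<phi> g h x)"
  by (induction s arbitrary: \<phi> x) auto

lemma cube_sum:
  "cube s (\<lambda>x. \<Sum>j\<in>J. w j * \<phi> j x) g h x = (\<Sum>j\<in>J. w j * cube s (\<phi> j) g h (x :: nat) :: 'a::comm_ring_1)"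
  by (induction s) (auto simp: sum_distrib_left mult_ac)

lemma cube_one: "cube s \<phi> (\<lambda>_. 1) h x = \<phi> x"
proof (induction s arbitrary: \<phi> x)
  case (Suc s)
  show ?case
    using Suc[of \<phi> x] Suc[of "\<lambda>_. 1"] by simp
qed simp

lemma norm_cube_le_1:
  fixes g :: "nat \<Rightarrow> complex"
  assumes "\<And>x. cmod (\<phi> x) \<le> 1" "\<And>x. cmod (g x) \<le> 1"
  shows "cmod (cube s \<phi> g h x) \<le> 1"
  using assms
proof (induction s arbitrary: \<phi> x)
  case (Suc s)
  then show ?case
    by (simp add: norm_mult mult_le_one)
qed simp

lemma prod_cube:
  "(\<Prod>\<omega>\<in>{..<s} \<rightarrow>\<^sub>E {0, 1}. f (x + (\<Sum>i<s. \<omega> i * h i))) = cube s f f h x"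
proof (induction s arbitrary: x)
  case (Suc s)
  have "(\<Prod>\<omega>\<in>{..<Suc s} \<rightarrow>\<^sub>E {0, 1}. f (x + (\<Sum>i<Suc s. \<omega> i * h i))) =
     (\<Prod>\<omega>\<in>{..<s} \<rightarrow>\<^sub>E {0, 1}. f (x + (\<Sum>i<s. \<omega> i * h i)) * f ((x + h s) + (\<Sum>i<s. \<omega> i * h i)))"
    unfolding prod_PiE_lessThan_Suc by (simp add: add_ac)
  then show ?case
    by (simp only: prod.distrib Suc cube.simps)
qed (simp add: PiE_def)

text \<open>Summing over the last edge makes two opposite faces independent.\<close>

lemma sum_cube_Suc:
  fixes g :: "nat \<Rightarrow> 'a::comm_ring_1"
  assumes "\<And>x. g (x + N) = g x"
  shows "(\<Sum>h\<in>{..<Suc s} \<rightarrow>\<^sub>E {..<N}. \<Sum>x<N. cube (Suc s) \<phi> g h x) =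
    (\<Sum>h\<in>{..<s} \<rightarrow>\<^sub>E {..<N}. (\<Sum>x<N. cube s \<phi> g h x) * (\<Sum>x<N. cube s g g h x))"
proof -
  have "cube s g g h (x + N) = cube s g g h x" for h x
    by (rule cube_periodic) (use assms in auto)
  then show ?thesis
    unfolding sum_PiE_lessThan_Suc by (simp add: sum_mult_shift)
qed

text \<open>When the separated vertex also carries \<open>g\<close>, the two opposite faces have the
  same sum, so that \<open>sum_cube_Suc\<close> gives a sum of squares.\<close>

lemma sum_cube_nonneg:
  fixes g :: "nat \<Rightarrow> real"
  assumes "\<And>x. g (x + N) = g x" "s > 0"
  shows "0 \<le> (\<Sum>h\<in>{..<s} \<rightarrow>\<^sub>E {..<N}. \<Sum>x<N. cube s g g h x)"
proof -
  obtain m where "s = Suc m"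
    using assms(2) gr0_implies_Suc by blast
  then show ?thesis
    using sum_cube_Suc[of g N m g] assms(1) by (auto intro!: sum_nonneg)
qed

section \<open>Weyl sums and Gowers averages of polynomial phases\<close>

text \<open>The bound for a phase of degree \<open>s\<close>. The square root comes from
  Cauchy-Schwarz, \<open>1 / real N\<close> from the zero shift, which is bounded trivially, and
  \<open>weyl_err N s\<close> from the other shifts, where the degree has dropped by one.\<close>

primrec weyl_err :: "nat \<Rightarrow> nat \<Rightarrow> real" where
  "weyl_err N 0 = 0"
| "weyl_err N (Suc s) = sqrt (1 / real N + weyl_err N s)"

lemma weyl_err_nonneg: "weyl_err N s \<ge> 0"
  by (induction s) auto

lemma weyl_err_tendsto: "((\<lambda>N. weyl_err N s) \<longlongrightarrow> 0) at_top"
proof (induction s)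
  case (Suc s)
  have "((\<lambda>N. sqrt (1 / real N + weyl_err N s)) \<longlongrightarrow> sqrt (0 + 0)) at_top"
    by (intro tendsto_intros Suc lim_1_over_n)
  then show ?case
    by simp
qed simp

text \<open>The leading coefficient is recorded because it has to stay nonzero modulo a prime
  \<open>N\<close>. It does so for \<open>0 < h < N\<close> as long as
  \<open>Suc s < N\<close>.\<close>

lemma polyfun_difference:
  fixes a :: "nat \<Rightarrow> int"
  shows "\<exists>b. (\<forall>x. (\<Sum>j\<le>Suc s. a j * (x + h) ^ j) - (\<Sum>j\<le>Suc s. a j * x ^ j) = (\<Sum>j\<le>s. b j * x ^ j))
    \<and> b s = int (Suc s) * h * a (Suc s)"
proof -
  define b where "b = (\<lambda>i. \<Sum>j\<in>{Suc i..Suc s}. a j * of_nat (j choose i) * h ^ (j - i))"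
  have b_lead: "b s = int (Suc s) * h * a (Suc s)"
    by (simp add: b_def)
  have "(\<Sum>j\<le>Suc s. a j * (x + h) ^ j) - (\<Sum>j\<le>Suc s. a j * x ^ j) = (\<Sum>i\<le>s. b i * x ^ i)" for x
  proof -
    have "a j * (x + h) ^ j - a j * x ^ j = (\<Sum>i<j. a j * of_nat (j choose i) * x ^ i * h ^ (j - i))" for j
      by (simp add: binomial_ring sum_distrib_left mult.assoc distrib_left flip: lessThan_Suc_atMost)
    then have "(\<Sum>j\<le>Suc s. a j * (x + h) ^ j) - (\<Sum>j\<le>Suc s. a j * x ^ j) =
        (\<Sum>j\<le>Suc s. \<Sum>i<j. a j * of_nat (j choose i) * x ^ i * h ^ (j - i))"
      by (simp only: flip: sum_subtractf)
    also have "\<dots> = (\<Sum>i<Suc s. \<Sum>j\<in>{Suc i..Suc s}. a j * of_nat (j choose i) * x ^ i * h ^ (j - i))"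
      by (rule sum.nested_swap')
    also have "\<dots> = (\<Sum>i\<le>s. b i * x ^ i)"
      unfolding b_def lessThan_Suc_atMost by (auto intro!: sum.cong simp: sum_distrib_left mult_ac simp del: sum.cl_ivl_Suc)
    finally show ?thesis .
  qed
  with b_lead show ?thesis
    by blast
qed

lemma of_real_norm_sum_squared:
  fixes C :: "nat \<Rightarrow> complex"
  assumes "\<And>x. C (x + N) = C x"
  shows "of_real ((cmod (\<Sum>x<N. C x))\<^sup>2) = (\<Sum>t<N. \<Sum>x<N. C (x + t) * cnj (C x))"
  unfolding complex_norm_square
  using sum_mult_shift[of C N "\<lambda>x. cnj (C x)"] assms
  by (simp add: mult.commute)

text \<open>Each application of the Cauchy--Schwarz inequality removes one direction of the cube and
  differentiates the phase once, down to a linear phase.\<close>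

lemma norm_sum_cube_le:
  fixes g :: "nat \<Rightarrow> complex" and a :: "nat \<Rightarrow> int"
  assumes "prime N" "Suc s < N" "\<not> int N dvd a (Suc s)"
    and "\<And>x. g (x + N) = g x" "\<And>x. cmod (g x) \<le> 1"
  shows "cmod (\<Sum>h\<in>{..<Suc s} \<rightarrow>\<^sub>E {..<N}. \<Sum>x<N.
      cube (Suc s) (\<lambda>x. e_mod N (\<Sum>j\<le>Suc s. a j * int x ^ j)) g h x)
    \<le> weyl_err N (Suc s) * real N ^ (s + 2)"
  using assms(2-)
proof (induction s arbitrary: a g)
  case 0
  have N: "N > 0"
    using 0 by simp
  have "(\<Sum>x<N. e_mod N (\<Sum>j\<le>Suc 0. a j * int x ^ j)) = 0"
    using sum_e_mod_linear[OF N, of "a 1" "a 0"] 0 by (simp add: add.commute)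
  then show ?case
    unfolding sum_cube_Suc[of g N, OF 0(3)] using weyl_err_nonneg[of N 0] by (simp del: sum.atMost_Suc)
next
  case (Suc s)
  define r where "r = Suc s"
  define \<phi> where "\<phi> = (\<lambda>x. e_mod N (\<Sum>j\<le>Suc r. a j * int x ^ j))"
  define A where "A = (\<lambda>h. \<Sum>x<N. cube r \<phi> g h x)"
  define B where "B = (\<lambda>h. \<Sum>x<N. cube r g g h x)"
  let ?H = "{..<r} \<rightarrow>\<^sub>E {..<N}"
  have N: "N > 0"
    using Suc.prems by simp
  have per: "\<phi> (x + N) = \<phi> x" for x
    unfolding \<phi>_def
  proof (rule e_mod_cong[OF N])
    have "int N dvd int (x + N) ^ j - int x ^ j" for j
      unfolding power_diff_sumr2 by simp
    then show "int N dvd (\<Sum>j\<le>Suc r. a j * int (x + N) ^ j) - (\<Sum>j\<le>Suc r. a j * int x ^ j)"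
      unfolding sum_subtractf[symmetric] right_diff_distrib[symmetric] by (intro dvd_sum dvd_mult)
  qed
  have finH: "finite ?H" and cardH: "card ?H = N ^ r"
    by (auto simp: finite_PiE card_PiE)
  have \<phi>1: "cmod (\<phi> x) \<le> 1" for x
    by (simp add: \<phi>_def)
  have cper: "cube r \<phi> g h (x + N) = cube r \<phi> g h x" for h x
    by (rule cube_periodic) (use per Suc.prems in auto)
  have B_le: "cmod (B h) \<le> N" for h
    unfolding B_def using Suc.prems norm_cube_le_1[of g g]
    by (intro order.trans[OF norm_sum] order.trans[OF sum_bounded_above[where K=1]]) auto
  have diff: "cmod (\<Sum>h\<in>?H. \<Sum>x<N. cube r \<phi> g h (x + t) * cnj (cube r \<phi> g h x))
      \<le> (if t = 0 then 1 else weyl_err N r) * real N ^ (r + 1)" if t: "t < N" for t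
  proof (cases "t = 0")
    case True
    have "cmod (cube r \<phi> g h (x + t) * cnj (cube r \<phi> g h x)) \<le> 1" for h x
      using norm_cube_le_1[of \<phi> g r h, OF \<phi>1] Suc.prems by (simp add: norm_mult mult_le_one)
    then have "cmod (\<Sum>h\<in>?H. \<Sum>x<N. cube r \<phi> g h (x + t) * cnj (cube r \<phi> g h x))
        \<le> (\<Sum>h\<in>?H. \<Sum>x<N. 1)"
      by (intro order.trans[OF norm_sum] sum_mono)
    then show ?thesis
      using True by (simp add: cardH mult.commute)
  next
    case False
    \<comment> \<open>The other vertices only have to be periodic and bounded by 1. Both properties
      pass to the derivative, which is why the induction runs over arbitrary
      \<open>g\<close>.\<close>
    define g' where "g' = (\<lambda>x. g (x + t) * cnj (g x))"
    obtain b where b: "\<And>x. (\<Sum>j\<le>Suc r. a j * (x + int t) ^ j) - (\<Sum>j\<le>Suc r. a j * x ^ j) = (\<Sum>j\<le>r. b j * x ^ j)"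
      and br: "b r = int (Suc r) * int t * a (Suc r)"
      using polyfun_difference[where a=a and s=r and h="int t"] by metis
    have "cube r \<phi> g h (x + t) * cnj (cube r \<phi> g h x) =
        cube r (\<lambda>x. e_mod N (\<Sum>j\<le>r. b j * int x ^ j)) g' h x" for h x
      by (simp add: g'_def \<phi>_def e_mod_diff flip: b cube_shift[of _ _ t] cube_cnj cube_mult)
    moreover have "\<not> int N dvd b r"
    proof
      assume "int N dvd b r"
      then have "int N dvd int (Suc r) \<or> int N dvd int t \<or> int N dvd a (Suc r)"
        using assms(1) unfolding br by (simp add: prime_dvd_mult_iff)
      then show False
        using Suc.prems False t by (auto simp: r_def dest!: zdvd_imp_le nat_dvd_not_less)
    qed
    moreover have "g' (x + N) = g' x" "cmod (g' x) \<le> 1" for x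
      using Suc.prems(3)[of "x + t"] Suc.prems(3)[of x] Suc.prems(4)
      by (simp_all add: g'_def norm_mult mult_le_one add.assoc add.commute[of N t])
    ultimately show ?thesis
      using Suc.IH[of b g'] Suc.prems False by (simp add: r_def)
  qed
  have eq: "complex_of_real (\<Sum>h\<in>?H. (cmod (A h))\<^sup>2) =
      (\<Sum>t<N. \<Sum>h\<in>?H. \<Sum>x<N. cube r \<phi> g h (x + t) * cnj (cube r \<phi> g h x))"
    unfolding A_def of_real_sum of_real_norm_sum_squared[of "cube r \<phi> g h" N for h, OF cper]
    by (rule sum.swap)
  have "(\<Sum>h\<in>?H. (cmod (A h))\<^sup>2) = cmod (complex_of_real (\<Sum>h\<in>?H. (cmod (A h))\<^sup>2))"
    unfolding norm_of_real by (intro abs_of_nonneg[symmetric] sum_nonneg) simp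
  also have "\<dots> = cmod (\<Sum>t<N. \<Sum>h\<in>?H. \<Sum>x<N. cube r \<phi> g h (x + t) * cnj (cube r \<phi> g h x))"
    unfolding eq ..
  also have "\<dots> \<le> (\<Sum>t<N. (if t = 0 then 1 else weyl_err N r) * real N ^ (r + 1))"
    by (intro order.trans[OF norm_sum] sum_mono diff) auto
  also have "\<dots> \<le> (\<Sum>t<N. (if t = 0 then real N ^ (r + 1) else 0) + weyl_err N r * real N ^ (r + 1))"
    using weyl_err_nonneg[of N r] by (intro sum_mono) auto
  also have "\<dots> = (1 / N + weyl_err N r) * real N ^ (r + 2)"
    using N by (simp add: sum.distrib field_simps)
  finally have A_le: "(\<Sum>h\<in>?H. (cmod (A h))\<^sup>2) \<le> (1 / N + weyl_err N r) * real N ^ (r + 2)" .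
  have "cmod (\<Sum>h\<in>{..<Suc r} \<rightarrow>\<^sub>E {..<N}. \<Sum>x<N. cube (Suc r) \<phi> g h x) = cmod (\<Sum>h\<in>?H. A h * B h)"
    unfolding sum_cube_Suc[of g N, OF Suc.prems(3)] A_def B_def ..
  also have "\<dots> \<le> (\<Sum>h\<in>?H. cmod (A h) * N)"
    using B_le by (intro order.trans[OF norm_sum] sum_mono) (auto simp: norm_mult mult_left_mono)
  finally have "(cmod (\<Sum>h\<in>{..<Suc r} \<rightarrow>\<^sub>E {..<N}. \<Sum>x<N. cube (Suc r) \<phi> g h x))\<^sup>2
      \<le> (\<Sum>h\<in>?H. cmod (A h) * N)\<^sup>2"
    by (intro power_mono) auto
  also have "\<dots> \<le> (\<Sum>h\<in>?H. (cmod (A h))\<^sup>2) * (\<Sum>h\<in>?H. (real N)\<^sup>2)"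
    by (rule Cauchy_Schwarz_ineq_sum)
  also have "\<dots> \<le> ((1 / N + weyl_err N r) * real N ^ (r + 2)) * (\<Sum>h\<in>?H. (real N)\<^sup>2)"
    by (intro mult_right_mono A_le sum_nonneg) auto
  also have "\<dots> = (1 / N + weyl_err N r) * (real N ^ (r + 2))\<^sup>2"
    by (simp add: cardH power_add power2_eq_square)
  also have "\<dots> = (weyl_err N (Suc r) * real N ^ (r + 2))\<^sup>2"
    using weyl_err_nonneg[of N r] by (simp add: power_mult_distrib)
  finally show ?case
    unfolding \<phi>_def r_def by (rule power2_le_imp_le) (use weyl_err_nonneg[of N "Suc (Suc s)"] in simp)
qed

text \<open>For constant \<open>g = 1\<close> a cube product collapses to its separated vertex, and
  the sum over the edges contributes just a factor \<open>N ^ s\<close>.\<close>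

lemma weyl_bound:
  fixes a :: "nat \<Rightarrow> int"
  assumes "prime N" "s < N" "s > 0" "\<not> int N dvd a s"
  shows "cmod (\<Sum>x<N. e_mod N (\<Sum>j\<le>s. a j * int x ^ j)) \<le> weyl_err N s * real N"
proof -
  obtain m where s: "s = Suc m"
    using assms(3) gr0_implies_Suc by blast
  have "real N ^ s * cmod (\<Sum>x<N. e_mod N (\<Sum>j\<le>s. a j * int x ^ j)) \<le> real N ^ s * (weyl_err N s * real N)"
    using norm_sum_cube_le[of N m a "\<lambda>_. 1"] assms unfolding s cube_one
    by (simp add: norm_mult norm_power card_PiE mult_ac del: weyl_err.simps sum.atMost_Suc)
  then show ?thesis
    using assms by simp
qed

section \<open>Polynomial phases in two variables\<close>

text \<open>Lagrange's bound. A root \<open>y\<close> splits off the factor \<open>x - y\<close>;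
  modulo a prime every other root is a root of the quotient, which has the same leading
  coefficient.\<close>

lemma card_roots_mod_prime_le:
  fixes a :: "nat \<Rightarrow> int"
  assumes "prime p" "\<not> int p dvd a n"
  shows "card {x. x < p \<and> int p dvd (\<Sum>j\<le>n. a j * int x ^ j)} \<le> n"
  using assms(2)
proof (induction n arbitrary: a)
  case (Suc n)
  define P where "P = (\<lambda>a n x. int p dvd (\<Sum>j\<le>n. a j * int x ^ j))"
  show ?case
  proof (cases "\<exists>y<p. P a (Suc n) y")
    case False
    then have "{x. x < p \<and> P a (Suc n) x} = {}"
      by blast
    then show ?thesis
      by (simp only: P_def card.empty zero_le)
  next
    case True
    then obtain y where y: "y < p" "P a (Suc n) y"
      by blast
    define b where "b = (\<lambda>j. \<Sum>k<Suc n - j. a (j + k + 1) * int y ^ k)"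
    have fac: "(\<Sum>j\<le>Suc n. a j * int x ^ j) - (\<Sum>j\<le>Suc n. a j * int y ^ j) =
        (int x - int y) * (\<Sum>j\<le>n. b j * int x ^ j)" for x
      unfolding b_def using sub_polyfun_alt[where n="Suc n" and a=a and x="int x" and y="int y"]
      by (simp add: lessThan_Suc_atMost sum_distrib_right del: sum.atMost_Suc)
    have "{x. x < p \<and> P a (Suc n) x} \<subseteq> insert y {x. x < p \<and> P b n x}"
    proof (rule subsetI, rule ccontr)
      fix x
      assume "x \<in> {x. x < p \<and> P a (Suc n) x}" "x \<notin> insert y {x. x < p \<and> P b n x}"
      then have x: "x < p" "P a (Suc n) x" "\<not> P b n x" "x \<noteq> y"
        by auto
      then have "int p dvd (int x - int y) * (\<Sum>j\<le>n. b j * int x ^ j)"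
        using y(2) unfolding P_def fac[symmetric] by (intro dvd_diff) auto
      then have "int p dvd int x - int y"
        using x(3) assms(1) by (simp add: prime_dvd_mult_iff P_def)
      then have "int x mod int p = int y mod int p"
        by (simp add: mod_eq_dvd_iff)
      then show False
        using x y by simp
    qed
    then have "card {x. x < p \<and> P a (Suc n) x} \<le> card (insert y {x. x < p \<and> P b n x})"
      by (intro card_mono) auto
    also have "\<dots> \<le> Suc (card {x. x < p \<and> P b n x})"
      by (rule card_insert_le_m1) auto
    also have "\<dots> \<le> Suc n"
      using Suc.IH[of b] Suc.prems by (simp add: P_def b_def)
    finally show ?thesis
      by (simp add: P_def)
  qed
qed (use assms in auto)

section \<open>Limits along the primes\<close>

definition primes_at_top :: "nat filter" where
  "primes_at_top = inf at_top (principal {N. prime N})"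

lemma eventually_primes_at_top:
  "eventually P primes_at_top \<longleftrightarrow> (\<exists>N0. \<forall>N\<ge>N0. prime N \<longrightarrow> P N)"
  by (simp add: primes_at_top_def eventually_inf_principal eventually_at_top_linorder)

lemma primes_at_top_le: "primes_at_top \<le> at_top"
  by (simp add: primes_at_top_def)

lemma eventually_not_dvd_primes_at_top:
  assumes "c \<noteq> 0"
  shows "\<forall>\<^sub>F N in primes_at_top. \<not> int N dvd c"
  unfolding eventually_primes_at_top
proof (intro exI allI impI)
  fix N
  assume "N \<ge> nat \<bar>c\<bar> + 1"
  then show "\<not> int N dvd c"
    using dvd_imp_le_int[of c "int N"] assms by linarith
qed

lemma eventually_prime_primes_at_top: "\<forall>\<^sub>F N in primes_at_top. prime N \<and> N > m"
  unfolding eventually_primes_at_top by (rule exI[of _ "Suc m"]) auto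

lemma last_nonzero:
  fixes q :: "nat \<Rightarrow> 'a::zero"
  assumes "j \<le> s" "q j \<noteq> 0"
  obtains m where "j \<le> m" "m \<le> s" "q m \<noteq> 0" "\<And>i. m < i \<Longrightarrow> i \<le> s \<Longrightarrow> q i = 0"
proof -
  define m where "m = Max {i. i \<le> s \<and> q i \<noteq> 0}"
  have fin: "finite {i. i \<le> s \<and> q i \<noteq> 0}"
    by simp
  then have "m \<in> {i. i \<le> s \<and> q i \<noteq> 0}"
    unfolding m_def using assms by (intro Max_in) auto
  moreover have "i \<le> m" if "i \<le> s" "q i \<noteq> 0" for i
    unfolding m_def using fin that by (intro Max_ge) auto
  ultimately show ?thesis
    using that[of m] assms by force
qed

text \<open>Expand in powers of one variable and discard the few values of the other one at which the
  leading coefficient is zero modulo the prime.\<close>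

lemma two_variable_weyl_aux:
  fixes b :: "nat \<Rightarrow> int" and c :: "nat \<Rightarrow> nat \<Rightarrow> int"
  assumes "prime N" "m < N" "m > 0" "\<not> int N dvd b n"
    and c: "\<And>y. c m y = (\<Sum>j\<le>n. b j * int y ^ j)"
  shows "cmod (\<Sum>y<N. \<Sum>x<N. e_mod N (\<Sum>i\<le>m. c i y * int x ^ i))
    \<le> (n / N + weyl_err N m) * real N ^ 2"
proof -
  define R where "R = {y. y < N \<and> int N dvd c m y}"
  have R: "R \<subseteq> {..<N}" "finite R"
    by (auto simp: R_def)
  have "cmod (\<Sum>x<N. e_mod N (\<Sum>i\<le>m. c i y * int x ^ i))
      \<le> (if y \<in> R then real N else 0) + weyl_err N m * real N" if "y < N" for y
  proof (cases "y \<in> R")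
    case True
    have "cmod (\<Sum>x<N. e_mod N (\<Sum>i\<le>m. c i y * int x ^ i)) \<le> (\<Sum>x<N. 1)"
      by (intro order.trans[OF norm_sum] sum_mono) simp
    then show ?thesis
      using True weyl_err_nonneg[of N m] by (simp add: add_increasing2)
  next
    case False
    then show ?thesis
      using weyl_bound[OF assms(1-3), of "\<lambda>i. c i y"] that by (simp add: R_def)
  qed
  then have "cmod (\<Sum>y<N. \<Sum>x<N. e_mod N (\<Sum>i\<le>m. c i y * int x ^ i))
      \<le> (\<Sum>y<N. (if y \<in> R then real N else 0) + weyl_err N m * real N)"
    by (intro sum_norm_le) simp
  also have "(\<Sum>y<N. if y \<in> R then real N else 0) = (\<Sum>y\<in>R. real N)"
    using R(1) by (simp add: Int_absorb1 flip: sum.inter_restrict)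
  then have "(\<Sum>y<N. (if y \<in> R then real N else 0) + weyl_err N m * real N) =
      card R * real N + weyl_err N m * real N ^ 2"
    by (simp add: sum.distrib power2_eq_square)
  also have "\<dots> \<le> real n * real N + weyl_err N m * real N ^ 2"
    using card_roots_mod_prime_le[of N b n] assms by (simp add: R_def mult_right_mono)
  also have "\<dots> = (n / N + weyl_err N m) * real N ^ 2"
    using assms by (simp add: field_simps power2_eq_square)
  finally show ?thesis .
qed

text \<open>A nonconstant monomial contains one of the variables, and exchanging them makes it
  \<open>x\<close>. The coefficients are fixed integers, so the nonzero ones are not divisible by
  any large prime.\<close>

lemma two_variable_weyl:
  fixes q :: "nat \<Rightarrow> nat \<Rightarrow> int"
  assumes "i0 \<le> s" "j0 \<le> s" "q i0 j0 \<noteq> 0" "i0 + j0 > 0"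
  shows "((\<lambda>N. (\<Sum>x<N. \<Sum>y<N. e_mod N (\<Sum>i\<le>s. \<Sum>j\<le>s. q i j * int x ^ i * int y ^ j)) / of_nat N ^ 2)
    \<longlongrightarrow> 0) primes_at_top"
proof -
  have main: "((\<lambda>N. (\<Sum>y<N. \<Sum>x<N. e_mod N (\<Sum>i\<le>s. \<Sum>j\<le>s. q i j * int x ^ i * int y ^ j)) / of_nat N ^ 2)
      \<longlongrightarrow> 0) primes_at_top"
    if ij: "i0 \<le> s" "j0 \<le> s" "q i0 j0 \<noteq> 0" "i0 > 0" for q :: "nat \<Rightarrow> nat \<Rightarrow> int" and i0 j0
  proof -
    obtain m where m: "i0 \<le> m" "m \<le> s" "\<exists>j\<le>s. q m j \<noteq> 0"
      and m_max: "\<And>i. m < i \<Longrightarrow> i \<le> s \<Longrightarrow> \<forall>j\<le>s. q i j = 0"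
    proof (rule last_nonzero[of i0 s "\<lambda>i. of_bool (\<exists>j\<le>s. q i j \<noteq> 0) :: nat"])
      show "of_bool (\<exists>j\<le>s. q i0 j \<noteq> 0) \<noteq> (0 :: nat)"
        using ij by auto
    qed (use ij that in simp_all)
    obtain j where j: "j \<le> s" "q m j \<noteq> 0"
      using m(3) by blast
    then obtain n where n: "n \<le> s" "q m n \<noteq> 0" and n_max: "\<And>j. n < j \<Longrightarrow> j \<le> s \<Longrightarrow> q m j = 0"
      by (rule last_nonzero) blast
    have eq: "(\<Sum>i\<le>s. \<Sum>j\<le>s. q i j * int x ^ i * int y ^ j) =
        (\<Sum>i\<le>m. (\<Sum>j\<le>s. q i j * int y ^ j) * int x ^ i)" for x y
    proof -
      have "(\<Sum>i\<le>s. \<Sum>j\<le>s. q i j * int x ^ i * int y ^ j) =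
          (\<Sum>i\<le>m. \<Sum>j\<le>s. q i j * int x ^ i * int y ^ j)"
        using m m_max by (intro sum.mono_neutral_right) auto
      then show ?thesis
        by (simp add: sum_distrib_left mult_ac)
    qed
    have row: "(\<Sum>j\<le>s. q m j * int y ^ j) = (\<Sum>j\<le>n. q m j * int y ^ j)" for y
      using n n_max by (intro sum.mono_neutral_right) auto
    have "\<forall>\<^sub>F N in primes_at_top. cmod ((\<Sum>y<N. \<Sum>x<N.
        e_mod N (\<Sum>i\<le>s. \<Sum>j\<le>s. q i j * int x ^ i * int y ^ j)) / of_nat N ^ 2)
        \<le> n / N + weyl_err N m"
      using eventually_prime_primes_at_top[of m] eventually_not_dvd_primes_at_top[OF n(2)]
    proof eventually_elim
      case (elim N)
      then show ?case
        using two_variable_weyl_aux[of N m "q m" n "\<lambda>i y. \<Sum>j\<le>s. q i j * int y ^ j"] row m ij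
        unfolding eq norm_divide norm_power norm_of_nat by (subst pos_divide_le_eq) auto
    qed
    moreover have "((\<lambda>N. real n / N + weyl_err N m) \<longlongrightarrow> 0) primes_at_top"
      using tendsto_mono[OF primes_at_top_le tendsto_add[OF lim_const_over_n[of "real n"] weyl_err_tendsto[of m]]]
      by simp
    ultimately show ?thesis
      by (rule Lim_null_comparison)
  qed
  show ?thesis
  proof (cases "i0 > 0")
    case True
    then show ?thesis
      using main[of i0 j0 q] assms by (subst sum.swap) simp
  next
    case False
    have eq: "(\<Sum>i\<le>s. \<Sum>j\<le>s. q j i * int y ^ i * int x ^ j) = (\<Sum>i\<le>s. \<Sum>j\<le>s. q i j * int x ^ i * int y ^ j)" for x y
      by (subst sum.swap) (simp add: mult_ac)
    then show ?thesis
      using main[of j0 i0 "\<lambda>i j. q j i"] assms False by simp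
  qed
qed

section \<open>Linear relations along progressions\<close>

text \<open>Up to sign this is the \<open>n\<close>-th finite difference at 0 of a polynomial of
  degree less than \<open>n\<close>. Pascal's rule turns it into minus the corresponding sum for
  \<open>n - 1\<close> and the first difference, whose degree is one lower.\<close>

lemma sum_alternating_binomial_polyfun:
  fixes a :: "nat \<Rightarrow> int"
  assumes "m < n"
  shows "(\<Sum>i\<le>n. (- 1) ^ i * int (n choose i) * (\<Sum>j\<le>m. a j * int i ^ j)) = 0"
  using assms
proof (induction m arbitrary: n a)
  case 0
  then show ?case
    using choose_alternating_sum[of n, where ?'a = int] by (simp flip: sum_distrib_right)
next
  case (Suc m)
  then obtain l where n: "n = Suc l" "m < l"
    by (cases n) auto
  define q where "q = (\<lambda>i. \<Sum>j\<le>Suc m. a j * int i ^ j)"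
  obtain b where b: "\<And>x. (\<Sum>j\<le>Suc m. a j * (x + 1) ^ j) - (\<Sum>j\<le>Suc m. a j * x ^ j) = (\<Sum>j\<le>m. b j * x ^ j)"
    using polyfun_difference[where a=a and s=m and h=1] by blast
  have diff: "q (Suc i) - q i = (\<Sum>j\<le>m. b j * int i ^ j)" for i
    using b[of "int i"] unfolding q_def by (simp add: add.commute del: sum.atMost_Suc)
  have "(\<Sum>i\<le>n. (- 1) ^ i * int (n choose i) * q i) =
      q 0 - (\<Sum>i\<le>l. (- 1) ^ i * int (l choose i) * q (Suc i)) - (\<Sum>i\<le>l. (- 1) ^ i * int (l choose Suc i) * q (Suc i))"
    unfolding n sum.atMost_Suc_shift by (simp add: algebra_simps sum.distrib sum_negf sum_subtractf)
  also have "q 0 - (\<Sum>i\<le>l. (- 1) ^ i * int (l choose Suc i) * q (Suc i)) =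
      (\<Sum>i\<le>Suc l. (- 1) ^ i * int (l choose i) * q i)"
    unfolding sum.atMost_Suc_shift by (simp add: sum_negf)
  then have "q 0 - (\<Sum>i\<le>l. (- 1) ^ i * int (l choose i) * q (Suc i)) - (\<Sum>i\<le>l. (- 1) ^ i * int (l choose Suc i) * q (Suc i)) =
      - (\<Sum>i\<le>l. (- 1) ^ i * int (l choose i) * (q (Suc i) - q i))"
    by (simp add: sum_subtractf right_diff_distrib)
  also have "\<dots> = 0"
    using Suc.IH[OF n(2)] by (simp add: diff)
  finally show ?case
    by (simp only: q_def)
qed

lemma sum_alternating_binomial_power:
  assumes "m < n"
  shows "(\<Sum>i\<le>n. (- 1) ^ i * int (n choose i) * int i ^ m) = 0"
proof -
  have "(\<Sum>j\<le>m. (if j = m then 1 else 0) * int i ^ j) = int i ^ m" for i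
    by (simp add: if_distrib[of "\<lambda>x. x * _"] cong: if_cong)
  then show ?thesis
    using sum_alternating_binomial_polyfun[OF assms, of "\<lambda>j. if j = m then 1 else 0"] by simp
qed

text \<open>The moments make \<open>a\<close> orthogonal to all polynomials of degree at most
  \<open>s\<close>. One of these vanishes at all of \<open>1, ..., Suc s\<close> except
  \<open>l\<close>; as \<open>a 0 = 0\<close>, it isolates \<open>a l\<close>.\<close>

lemma vanishing_moments:
  fixes a :: "nat \<Rightarrow> int"
  assumes "a 0 = 0" and mom: "\<And>m. m \<le> s \<Longrightarrow> (\<Sum>i\<le>Suc s. a i * int i ^ m) = 0" and l: "l \<le> Suc s"
  shows "a l = 0"
proof (cases "l = 0")
  case False
  define p where "p = (\<Prod>i\<in>{1..Suc s} - {l}. [:- int i, 1:])"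
  have p: "poly p x = (\<Prod>i\<in>{1..Suc s} - {l}. x - int i)" for x
    by (simp add: p_def poly_prod)
  have "degree p \<le> sum (degree \<circ> (\<lambda>i. [:- int i, 1:])) ({1..Suc s} - {l})"
    unfolding p_def by (rule degree_prod_sum_le) auto
  also have "\<dots> = s"
    using False l by simp
  finally have "degree p \<le> s" .
  have "(\<Sum>i\<le>Suc s. a i * poly p (int i)) = (\<Sum>j\<le>degree p. coeff p j * (\<Sum>i\<le>Suc s. a i * int i ^ j))"
    unfolding poly_altdef sum_distrib_left by (subst sum.swap) (simp add: mult_ac)
  also have "\<dots> = 0"
    using mom \<open>degree p \<le> s\<close> by (intro sum.neutral) auto
  also have "(\<Sum>i\<le>Suc s. a i * poly p (int i)) = (\<Sum>i\<in>{l}. a i * poly p (int i))"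
  proof (rule sum.mono_neutral_right)
    show "\<forall>i\<in>{..Suc s} - {l}. a i * poly p (int i) = 0"
    proof
      fix i
      assume i: "i \<in> {..Suc s} - {l}"
      show "a i * poly p (int i) = 0"
      proof (cases "i = 0")
        case False
        with i have "i \<in> {1..Suc s} - {l}"
          by auto
        then show ?thesis
          unfolding p by (subst prod_zero) auto
      qed (use assms in simp)
    qed
  qed (use l in auto)
  finally have "a l * poly p (int l) = 0"
    by simp
  moreover have "poly p (int l) \<noteq> 0"
    unfolding p by auto
  ultimately show ?thesis
    by simp
qed (use assms in simp)

text \<open>The relation is unique up to scaling: subtract the multiple of the binomial relation
  that agrees with \<open>a\<close> at 0.\<close>

lemma vanishing_moments_binomial:
  fixes a :: "nat \<Rightarrow> int"
  assumes "\<And>m. m \<le> s \<Longrightarrow> (\<Sum>i\<le>Suc s. a i * int i ^ m) = 0" "l \<le> Suc s"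
  shows "a l = a 0 * ((- 1) ^ l * int (Suc s choose l))"
proof -
  define b where "b = (\<lambda>i. a i - a 0 * ((- 1) ^ i * int (Suc s choose i)))"
  have mom: "(\<Sum>i\<le>Suc s. b i * int i ^ m) = 0" if "m \<le> s" for m
  proof -
    have "(\<Sum>i\<le>Suc s. b i * int i ^ m) = (\<Sum>i\<le>Suc s. a i * int i ^ m) -
        a 0 * (\<Sum>i\<le>Suc s. (- 1) ^ i * int (Suc s choose i) * int i ^ m)"
      unfolding b_def left_diff_distrib sum_subtractf sum_distrib_left by (simp only: mult.assoc)
    then show ?thesis
      using assms(1) sum_alternating_binomial_power[of m "Suc s"] that by simp
  qed
  have "b 0 = 0"
    by (simp add: b_def)
  then have "b l = 0"
    using mom assms(2) by (rule vanishing_moments)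
  then show ?thesis
    by (simp add: b_def)
qed

definition phase :: "nat \<Rightarrow> int \<times> int \<Rightarrow> nat \<Rightarrow> int" where
  "phase s p x = fst p * int x ^ s + snd p * int x"

text \<open>For \<open>s \<ge> 2\<close> this says that the sum of the phases
  \<open>\<sigma> i\<close> at \<open>x + i * d\<close> is the zero polynomial in \<open>x\<close>
  and \<open>d\<close>.\<close>

definition ap_relation :: "nat \<Rightarrow> nat \<Rightarrow> (nat \<Rightarrow> int \<times> int) \<Rightarrow> bool" where
  "ap_relation s k \<sigma> \<longleftrightarrow> (\<forall>m\<le>s. (\<Sum>i<k. fst (\<sigma> i) * int i ^ m) = 0)
     \<and> (\<Sum>i<k. snd (\<sigma> i)) = 0 \<and> (\<Sum>i<k. snd (\<sigma> i) * int i) = 0"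

lemma sum_phase_ap:
  "(\<Sum>i<k. phase s (\<sigma> i) (x + i * d)) =
     (\<Sum>m\<le>s. int (s choose m) * (\<Sum>i<k. fst (\<sigma> i) * int i ^ m) * int x ^ (s - m) * int d ^ m)
     + (\<Sum>i<k. snd (\<sigma> i)) * int x + (\<Sum>i<k. snd (\<sigma> i) * int i) * int d"
proof -
  have "fst (\<sigma> i) * int (x + i * d) ^ s =
      (\<Sum>m\<le>s. int (s choose m) * (fst (\<sigma> i) * int i ^ m) * int x ^ (s - m) * int d ^ m)" for i
    using binomial_ring[of "int (i * d)" "int x" s]
    by (simp add: add.commute sum_distrib_left power_mult_distrib mult_ac)
  then have "(\<Sum>i<k. fst (\<sigma> i) * int (x + i * d) ^ s) =
      (\<Sum>m\<le>s. int (s choose m) * (\<Sum>i<k. fst (\<sigma> i) * int i ^ m) * int x ^ (s - m) * int d ^ m)"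
    by (simp only: sum_distrib_left sum_distrib_right) (rule sum.swap)
  then show ?thesis
    by (simp add: phase_def sum.distrib distrib_left sum_distrib_right mult.assoc)
qed

text \<open>For \<open>s \<ge> 2\<close> the three summands belong to different monomials, since the
  first needs \<open>i + j = s\<close> and the others \<open>i + j = 1\<close>; hence no
  cancellation between them can hide a failed relation.\<close>

definition ap_coeff :: "nat \<Rightarrow> nat \<Rightarrow> (nat \<Rightarrow> int \<times> int) \<Rightarrow> nat \<Rightarrow> nat \<Rightarrow> int" where
  "ap_coeff s k \<sigma> i j =
    (if i + j = s then int (s choose j) * (\<Sum>l<k. fst (\<sigma> l) * int l ^ j) else 0)
    + (if i = 1 \<and> j = 0 then \<Sum>l<k. snd (\<sigma> l) else 0)
    + (if i = 0 \<and> j = 1 then \<Sum>l<k. snd (\<sigma> l) * int l else 0)"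

lemma sum_phase_ap_polyfun:
  assumes "s \<ge> 2"
  shows "(\<Sum>i<k. phase s (\<sigma> i) (x + i * d)) = (\<Sum>i\<le>s. \<Sum>j\<le>s. ap_coeff s k \<sigma> i j * int x ^ i * int d ^ j)"
proof -
  define M where "M = (\<lambda>j. \<Sum>i<k. fst (\<sigma> i) * int i ^ j)"
  define A where "A = (\<Sum>i<k. snd (\<sigma> i))"
  define B where "B = (\<Sum>i<k. snd (\<sigma> i) * int i)"
  let ?x = "int x" and ?d = "int d"
  have "(\<Sum>i\<le>s. if i + j = s then int (s choose j) * M j * ?x ^ i * ?d ^ j else 0)
      = int (s choose j) * M j * ?x ^ (s - j) * ?d ^ j" if "j \<le> s" for j
  proof -
    have "i + j = s \<longleftrightarrow> i = s - j" for i
      using that by auto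
    then show ?thesis
      by simp
  qed
  then have 1: "(\<Sum>i\<le>s. \<Sum>j\<le>s. if i + j = s then int (s choose j) * M j * ?x ^ i * ?d ^ j else 0)
      = (\<Sum>m\<le>s. int (s choose m) * M m * ?x ^ (s - m) * ?d ^ m)"
    by (subst sum.swap) (intro sum.cong, auto)
  have 2: "(\<Sum>i\<le>s. \<Sum>j\<le>s. if i = 1 \<and> j = 0 then A * ?x ^ i * ?d ^ j else 0) = A * ?x"
  proof -
    have "(if i = 1 \<and> j = 0 then A * ?x ^ i * ?d ^ j else 0) = (if j = 0 then (if i = 1 then A * ?x else 0) else 0)" for i j :: nat
      by simp
    then show ?thesis
      using assms by simp
  qed
  have 3: "(\<Sum>i\<le>s. \<Sum>j\<le>s. if i = 0 \<and> j = 1 then B * ?x ^ i * ?d ^ j else 0) = B * ?d"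
  proof -
    have "(if i = 0 \<and> j = 1 then B * ?x ^ i * ?d ^ j else 0) = (if j = 1 then (if i = 0 then B * ?d else 0) else 0)" for i j :: nat
      by simp
    then show ?thesis
      using assms by simp
  qed
  have "ap_coeff s k \<sigma> i j * ?x ^ i * ?d ^ j = (if i + j = s then int (s choose j) * M j * ?x ^ i * ?d ^ j else 0)
      + (if i = 1 \<and> j = 0 then A * ?x ^ i * ?d ^ j else 0) + (if i = 0 \<and> j = 1 then B * ?x ^ i * ?d ^ j else 0)" for i j
    unfolding ap_coeff_def M_def A_def B_def by (simp only: distrib_right if_distrib[of "\<lambda>x. x * _"] mult_zero_left)
  then show ?thesis
    unfolding sum_phase_ap by (simp only: sum.distrib 1 2 3) (simp only: M_def A_def B_def)
qed

text \<open>Phases have no constant term. So either the total phase is identically zero and every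
  summand is 1, or it has a nonzero coefficient at a nonconstant monomial and the Weyl bound
  applies.\<close>

lemma phase_ap_average:
  assumes "s \<ge> 2"
  shows "((\<lambda>N. (\<Sum>x<N. \<Sum>d<N. e_mod N (\<Sum>i<k. phase s (\<sigma> i) (x + i * d))) / of_nat N ^ 2)
    \<longlongrightarrow> of_bool (ap_relation s k \<sigma>)) primes_at_top"
proof (cases "ap_relation s k \<sigma>")
  case True
  then have zero: "(\<Sum>i<k. phase s (\<sigma> i) (x + i * d)) = 0" for x d
    unfolding sum_phase_ap ap_relation_def by simp
  have "\<forall>\<^sub>F N in primes_at_top.
      (\<Sum>x<N. \<Sum>d<N. e_mod N (\<Sum>i<k. phase s (\<sigma> i) (x + i * d))) / of_nat N ^ 2 = 1"
    by (rule eventually_mono[OF eventually_prime_primes_at_top[of 0]]) (simp add: zero power2_eq_square)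
  then show ?thesis
    using True by (simp add: tendsto_eventually)
next
  case False
  obtain i0 j0 where ij: "i0 \<le> s" "j0 \<le> s" "ap_coeff s k \<sigma> i0 j0 \<noteq> 0" "i0 + j0 > 0"
  proof -
    consider m where "m \<le> s" "(\<Sum>i<k. fst (\<sigma> i) * int i ^ m) \<noteq> 0"
      | "(\<Sum>i<k. snd (\<sigma> i)) \<noteq> 0" | "(\<Sum>i<k. snd (\<sigma> i) * int i) \<noteq> 0"
      using False unfolding ap_relation_def by blast
    then show thesis
    proof cases
      case 1
      then show thesis
        using assms by (intro that[of "s - m" m]) (auto simp: ap_coeff_def)
    next
      case 2
      then show thesis
        using assms by (intro that[of 1 0]) (auto simp: ap_coeff_def)
    next
      case 3
      then show thesis
        using assms by (intro that[of 0 1]) (auto simp: ap_coeff_def)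
    qed
  qed
  show ?thesis
    unfolding sum_phase_ap_polyfun[OF assms] using False two_variable_weyl[of i0 s j0 "ap_coeff s k \<sigma>", OF ij] by simp
qed

section \<open>The frequencies and their weights\<close>

text \<open>Separates the middle of the relation from its ends: the leading coefficients at
  positions \<open>2, ..., k - 3\<close> exceed \<open>k - 1\<close> in absolute value, so they
  never meet the frequencies that carry linear terms.\<close>

lemma binomial_gt_self:
  assumes "2 \<le> i" "i + 2 \<le> n"
  shows "n < n choose i"
proof -
  have *: "n < n choose i" if "2 \<le> i" "2 * i \<le> n" "4 \<le> n" for i
  proof -
    have "n * 3 \<le> n * (n - 1)"
      using that by (intro mult_le_mono) auto
    then have "n < n * (n - 1) div 2"
      using that by linarith
    also have "\<dots> \<le> n choose i"
      using binomial_mono[of 2 i n] that by (simp add: choose_two)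
    finally show ?thesis .
  qed
  show ?thesis
  proof (cases "2 * i \<le> n")
    case False
    then show ?thesis
      using *[of "n - i"] binomial_symmetric[of i n] assms by auto
  qed (use * assms in auto)
qed

text \<open>The leading coefficients are the binomial coefficients of the only linear relation between
  the values of a polynomial of degree \<open>k - 2\<close> along a \<open>k\<close>-term progression.\<close>

definition pos_freqs :: "nat \<Rightarrow> (int \<times> int) set" where
  "pos_freqs k = {(1, 0), (1, int k - 3), (int k - 1, int k - 2), (int k - 1, 1)}
     \<union> (\<lambda>i. (int (k - 1 choose i), 0)) ` {2..k - 3}"

definition freqs :: "nat \<Rightarrow> (int \<times> int) set" where
  "freqs k = {0} \<union> pos_freqs k \<union> uminus ` pos_freqs k"

text \<open>Symmetric under negation, which keeps the resulting function real. The value at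
  \<open>0\<close> is the intended mean; the sign is negative at one of the two frequencies with
  leading coefficient \<open>k - 1\<close> and at its opposite.\<close>

definition weight :: "nat \<Rightarrow> real \<Rightarrow> int \<times> int \<Rightarrow> real" where
  "weight k \<epsilon> p = (if p = 0 then 1 / 2 else if p \<in> {(int k - 1, 1), - (int k - 1, 1)} then - \<epsilon> else \<epsilon>)"

lemma finite_freqs: "finite (freqs k)"
  by (simp add: freqs_def pos_freqs_def)

lemma uminus_freqs: "p \<in> freqs k \<Longrightarrow> - p \<in> freqs k"
  by (auto simp: freqs_def)

lemma weight_uminus: "weight k \<epsilon> (- p) = weight k \<epsilon> p"
  by (cases p) (auto simp: weight_def zero_prod_def)

context
  fixes k :: nat
  assumes even: "even k" and ge4: "k \<ge> 4"
begin

lemma binomial_gt_pred: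
  assumes "2 \<le> i" "i + 3 \<le> k"
  shows "int (k - 1 choose i) > int k - 1"
proof -
  have "k - 1 < k - 1 choose i"
    using assms by (intro binomial_gt_self) auto
  then show ?thesis
    by linarith
qed

lemma choose_k_minus_2: "(k - 1) choose (k - 2) = k - 1"
  using binomial_symmetric[of 1 "k - 1"] ge4 by (simp add: numeral_2_eq_2)

lemma pos_freqs_cases:
  assumes "p \<in> pos_freqs k"
  obtains "p = (1, 0)" | "p = (1, int k - 3)" | "p = (int k - 1, int k - 2)" | "p = (int k - 1, 1)"
    | c where "p = (c, 0)" "c > int k - 1" "c \<le> int (k - 1 choose ((k - 1) div 2))"
proof -
  have "int (k - 1 choose i) > int k - 1" "int (k - 1 choose i) \<le> int (k - 1 choose ((k - 1) div 2))"
    if "i \<in> {2..k - 3}" for i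
    using that binomial_gt_pred[of i] binomial_maximum[of "k - 1" i] ge4 by auto
  then show ?thesis
    using assms that unfolding pos_freqs_def by blast
qed

text \<open>Used at the central position of a cancelling tuple, whose leading coefficient is the
  scaling factor times this binomial coefficient: the factor can then only be 0, 1 or -1.\<close>

lemma freqs_le: "p \<in> freqs k \<Longrightarrow> \<bar>fst p\<bar> \<le> int (k - 1 choose ((k - 1) div 2))"
proof -
  have C: "1 \<le> int (k - 1 choose ((k - 1) div 2))" "int k - 1 \<le> int (k - 1 choose ((k - 1) div 2))"
    using binomial_maximum[of "k - 1" 0] binomial_maximum[of "k - 1" 1] ge4 by simp_all linarith
  have "\<bar>fst p\<bar> \<le> int (k - 1 choose ((k - 1) div 2))" if "p \<in> pos_freqs k" for p
    using that by (cases rule: pos_freqs_cases) (use C ge4 in auto)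
  note pos = this[of p] this[of "- p"]
  assume "p \<in> freqs k"
  then have "p = 0 \<or> p \<in> pos_freqs k \<or> - p \<in> pos_freqs k"
    by (auto simp: freqs_def)
  then show "\<bar>fst p\<bar> \<le> int (k - 1 choose ((k - 1) div 2))"
    using pos by auto
qed

lemma fst_pos_freqs: "p \<in> pos_freqs k \<Longrightarrow> fst p > 0"
  by (cases rule: pos_freqs_cases) (use ge4 in auto)

text \<open>Excludes purely linear phases, so that every nonconstant phase has full degree and is
  covered by Weyl differencing.\<close>

lemma freqs_fst_0: "p \<in> freqs k \<Longrightarrow> fst p = 0 \<Longrightarrow> p = 0"
  by (auto simp: freqs_def dest!: fst_pos_freqs)

text \<open>The sign \<open>r\<close>, here and in the next three lemmas, treats a frequency and its
  opposite together, because the relation alternates in sign and may itself be negated.\<close>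

lemma freqs_fst_pos:
  assumes "p \<in> freqs k" "\<bar>r\<bar> = 1" "fst p = r * c" "c > 0"
  shows "r = 1 \<and> p \<in> pos_freqs k \<or> r = - 1 \<and> - p \<in> pos_freqs k"
proof -
  have "r = 1 \<or> r = - 1"
    using assms(2) by auto
  then show ?thesis
    using assms fst_pos_freqs by (fastforce simp: freqs_def)
qed

lemma freqs_fst_1:
  assumes "p \<in> freqs k" "\<bar>r\<bar> = 1" "fst p = r"
  shows "snd p \<in> {0, r * (int k - 3)}" "weight k \<epsilon> p = \<epsilon>"
proof -
  have "snd p \<in> {0, int k - 3} \<and> weight k \<epsilon> p = \<epsilon>" if "p \<in> pos_freqs k" "fst p = 1" for p
    using that by (cases rule: pos_freqs_cases) (use ge4 in \<open>auto simp: weight_def zero_prod_def\<close>)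
  then show "snd p \<in> {0, r * (int k - 3)}" "weight k \<epsilon> p = \<epsilon>"
    using freqs_fst_pos[of p r 1] assms weight_uminus[of k \<epsilon> p] by fastforce+
qed

lemma freqs_fst_pred:
  assumes "p \<in> freqs k" "\<bar>r\<bar> = 1" "fst p = r * (int k - 1)"
  shows "snd p = r * (int k - 2) \<and> weight k \<epsilon> p = \<epsilon> \<or> snd p = r \<and> weight k \<epsilon> p = - \<epsilon>"
proof -
  have "snd p = int k - 2 \<and> weight k \<epsilon> p = \<epsilon> \<or> snd p = 1 \<and> weight k \<epsilon> p = - \<epsilon>"
    if "p \<in> pos_freqs k" "fst p = int k - 1" for p
    using that by (cases rule: pos_freqs_cases) (use ge4 in \<open>auto simp: weight_def zero_prod_def\<close>)
  from this[of p] this[of "- p"] show ?thesis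
    using freqs_fst_pos[of p r "int k - 1"] assms weight_uminus[of k \<epsilon> p] ge4 by fastforce
qed

lemma freqs_fst_large:
  assumes "p \<in> freqs k" "\<bar>r\<bar> = 1" "fst p = r * c" "c > int k - 1"
  shows "snd p = 0" "weight k \<epsilon> p = \<epsilon>"
proof -
  have "snd p = 0 \<and> weight k \<epsilon> p = \<epsilon>" if "p \<in> pos_freqs k" "fst p > int k - 1" for p
    using that by (cases rule: pos_freqs_cases) (use ge4 in \<open>auto simp: weight_def zero_prod_def\<close>)
  from this[of p] this[of "- p"] show "snd p = 0" "weight k \<epsilon> p = \<epsilon>"
    using freqs_fst_pos[of p r c] assms weight_uminus[of k \<epsilon> p] ge4 by fastforce+
qed

lemma sum_end_indices:
  fixes f :: "nat \<Rightarrow> int"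
  assumes "\<And>i. 2 \<le> i \<Longrightarrow> i + 3 \<le> k \<Longrightarrow> f i = 0"
  shows "(\<Sum>i<k. f i) = f 0 + f 1 + f (k - 2) + f (k - 1)"
proof -
  have "(\<Sum>i<k. f i) = (\<Sum>i\<in>{0, 1, k - 2, k - 1}. f i)"
  proof (rule sum.mono_neutral_right)
    show "\<forall>i\<in>{..<k} - {0, 1, k - 2, k - 1}. f i = 0"
    proof
      fix i
      assume "i \<in> {..<k} - {0, 1, k - 2, k - 1}"
      then have "2 \<le> i" "i + 3 \<le> k"
        by auto
      then show "f i = 0"
        by (rule assms)
    qed
  qed (use ge4 in auto)
  moreover have "1 \<noteq> k - 2" "1 \<noteq> k - 1" "k - 2 \<noteq> k - 1" "0 \<noteq> k - 2" "0 \<noteq> k - 1"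
    using ge4 by auto
  ultimately show ?thesis
    by (simp del: One_nat_def)
qed

text \<open>For a nonconstant solution, the leading coefficients are \<open>r (-1)^i (k - 1 choose i)\<close> with
  \<open>r = 1\<close> or \<open>r = -1\<close>, and the relation between the linear coefficients forces exactly one of
  \<open>\<sigma> 1\<close> and \<open>\<sigma> (k - 2)\<close> to carry the negative weight.\<close>

lemma prod_weight_ap_relation:
  assumes mem: "\<And>i. i < k \<Longrightarrow> \<sigma> i \<in> freqs k" and rel: "ap_relation (k - 2) k \<sigma>"
    and nz: "l < k" "\<sigma> l \<noteq> 0"
  shows "(\<Prod>i<k. weight k \<epsilon> (\<sigma> i)) = - (\<epsilon> ^ k)"
proof -
  define r where "r = fst (\<sigma> 0)"
  have k: "{..<k} = {..Suc (k - 2)}" "Suc (k - 2) = k - 1"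
    using ge4 by auto
  have fst_\<sigma>: "fst (\<sigma> i) = r * ((- 1) ^ i * int (k - 1 choose i))" if "i < k" for i
    using vanishing_moments_binomial[of "k - 2" "\<lambda>i. fst (\<sigma> i)" i] rel that
    unfolding ap_relation_def k r_def by auto
  \<comment> \<open>If \<open>r\<close> were 0, all leading coefficients would vanish, and with them
    all of \<open>\<sigma>\<close>.\<close>
  have "r \<noteq> 0"
    using fst_\<sigma>[of l] nz mem freqs_fst_0[of "\<sigma> l"] by auto
  moreover have "\<bar>r\<bar> \<le> 1"
  proof -
    define C where "C = int (k - 1 choose ((k - 1) div 2))"
    have "C > 0"
      by (simp add: C_def zero_less_binomial_iff)
    have "\<bar>r\<bar> * C \<le> C"
      using freqs_le[OF mem, of "(k - 1) div 2"] fst_\<sigma>[of "(k - 1) div 2"] ge4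
      by (simp add: C_def abs_mult)
    then show ?thesis
      using \<open>C > 0\<close> by simp
  qed
  ultimately have r: "\<bar>r\<bar> = 1"
    by linarith
  have r': "\<bar>r * (- 1) ^ i\<bar> = 1" for i :: nat
    using r by (simp add: abs_mult power_abs)
  have mid: "snd (\<sigma> i) = 0" "weight k \<epsilon> (\<sigma> i) = \<epsilon>" if "2 \<le> i" "i + 3 \<le> k" for i
  proof -
    have "int (k - 1 choose i) > int k - 1"
      using that by (rule binomial_gt_pred)
    moreover have "i < k"
      using that by simp
    ultimately show "snd (\<sigma> i) = 0" "weight k \<epsilon> (\<sigma> i) = \<epsilon>"
      using freqs_fst_large[OF mem[of i] r'[of i]] fst_\<sigma>[of i] by (auto simp: mult.assoc)
  qed
  \<comment> \<open>Here the parity of \<open>k\<close> enters: \<open>k - 1\<close> is odd, so the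
    positions \<open>i\<close> and \<open>k - 1 - i\<close> receive opposite leading
    coefficients.\<close>
  have fst_ends: "fst (\<sigma> 1) = (- r) * (int k - 1)" "fst (\<sigma> (k - 2)) = r * (int k - 1)" "fst (\<sigma> (k - 1)) = - r"
    using fst_\<sigma>[of 1] fst_\<sigma>[of "k - 2"] fst_\<sigma>[of "k - 1"] ge4 even
    by (simp_all add: of_nat_diff choose_k_minus_2 choose_one algebra_simps del: One_nat_def)
  have lt: "0 < k" "1 < k" "k - 2 < k" "k - 1 < k"
    using ge4 by auto
  have r_neg: "\<bar>- r\<bar> = 1"
    using r by simp
  note s0 = freqs_fst_1(2)[OF mem[OF lt(1)] r r_def[symmetric]]
    and s1 = freqs_fst_pred[OF mem[OF lt(2)] r_neg fst_ends(1)]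
    and s2 = freqs_fst_pred[OF mem[OF lt(3)] r fst_ends(2)]
    and s3 = freqs_fst_1[OF mem[OF lt(4)] r_neg fst_ends(3)]
  have "(\<Sum>i<k. snd (\<sigma> i) * int i) = 0"
    using rel by (simp add: ap_relation_def)
  then have rel1: "snd (\<sigma> 1) + snd (\<sigma> (k - 2)) * (int k - 2) + snd (\<sigma> (k - 1)) * (int k - 1) = 0"
    using sum_end_indices[of "\<lambda>i. snd (\<sigma> i) * int i"] mid ge4 by (simp add: of_nat_diff)
  \<comment> \<open>This is what the linear terms are designed for. If the two were opposite, the
    first moment would force \<open>m\<close> to be \<open>0\<close> or \<open>r * (k - 1)\<close>,
    according to the option taken at position \<open>k - 1\<close>, while only
    \<open>r * (k - 2)\<close> and \<open>r\<close> are available.\<close>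
  have neq: "snd (\<sigma> (k - 2)) \<noteq> - snd (\<sigma> 1)"
  proof
    assume eq: "snd (\<sigma> (k - 2)) = - snd (\<sigma> 1)"
    define m where "m = snd (\<sigma> (k - 2))"
    have m: "m = r * (int k - 2) \<or> m = r"
      using s2 by (auto simp: m_def)
    have rel2: "m * (int k - 3) + snd (\<sigma> (k - 1)) * (int k - 1) = 0"
      using rel1 eq by (simp add: m_def algebra_simps)
    from s3(1) consider "snd (\<sigma> (k - 1)) = 0" | "snd (\<sigma> (k - 1)) = - r * (int k - 3)"
      by auto
    then show False
    proof cases
      case 1
      then show False
        using rel2 m r ge4 by auto
    next
      case 2
      have "(m - r * (int k - 1)) * (int k - 3) = 0"
        using rel2 unfolding 2 by (simp add: algebra_simps)
      then have "m = r * (int k - 1)"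
        using ge4 by simp
      moreover have "r = 1 \<or> r = - 1"
        using r by auto
      ultimately show False
        using m ge4 by auto
    qed
  qed
  have split: "{..<k} = {2..<k - 2} \<union> {0, 1, k - 2, k - 1}"
    using ge4 by auto
  have "(\<Prod>i\<in>{2..<k - 2}. weight k \<epsilon> (\<sigma> i)) = \<epsilon> ^ (k - 4)"
  proof -
    have "(\<Prod>i\<in>{2..<k - 2}. weight k \<epsilon> (\<sigma> i)) = (\<Prod>i\<in>{2..<k - 2}. \<epsilon>)"
      by (intro prod.cong) (auto intro!: mid(2))
    then show ?thesis
      by simp
  qed
  moreover have "(\<Prod>i\<in>{0, 1, k - 2, k - 1}. weight k \<epsilon> (\<sigma> i)) =
      \<epsilon> * weight k \<epsilon> (\<sigma> 1) * weight k \<epsilon> (\<sigma> (k - 2)) * \<epsilon>"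
  proof -
    have "1 \<noteq> k - 2" "1 \<noteq> k - 1" "k - 2 \<noteq> k - 1" "0 \<noteq> k - 2" "0 \<noteq> k - 1"
      using ge4 by auto
    then show ?thesis
      using s0 s3(2) by (simp add: mult.assoc del: One_nat_def)
  qed
  moreover have "{2..<k - 2} \<inter> {0, 1, k - 2, k - 1} = {}"
    by force
  ultimately have "(\<Prod>i<k. weight k \<epsilon> (\<sigma> i)) =
      \<epsilon> ^ (k - 4) * (\<epsilon> * weight k \<epsilon> (\<sigma> 1) * weight k \<epsilon> (\<sigma> (k - 2)) * \<epsilon>)"
    unfolding split by (subst prod.union_disjoint) auto
  \<comment> \<open>By \<open>neq\<close> the positions \<open>1\<close> and \<open>k - 2\<close>
    take different options, so one contributes \<open>\<epsilon>\<close> and the other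
    \<open>- \<epsilon>\<close>.\<close>
  also have "\<dots> = \<epsilon> ^ (k - 4) * (- (\<epsilon> ^ 4))"
    using s1[of \<epsilon>] s2[of \<epsilon>] neq by (auto simp: power4_eq_xxxx)
  also have "\<dots> = - (\<epsilon> ^ k)"
    using ge4 by (simp flip: power_add)
  finally show ?thesis .
qed

text \<open>Without a nonconstant cancelling tuple the limit would be exactly
  \<open>(1 / 2) ^ k\<close>. Up to sign, \<open>pos_freqs k\<close> consists of the values of the
  tuple given here.\<close>

lemma ex_ap_relation:
  "\<exists>\<sigma>\<in>{..<k} \<rightarrow>\<^sub>E freqs k. ap_relation (k - 2) k \<sigma> \<and> \<sigma> 0 \<noteq> 0"
proof -
  \<comment> \<open>The sum is \<open>(k - 3) - (k - 2) + 1 = 0\<close>, and the first moment is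
    \<open>- (k - 2) + (k - 2) = 0\<close>.\<close>
  define b where "b = (\<lambda>i. if i = 0 then int k - 3 else if i = 1 then - (int k - 2) else if i = k - 2 then 1 else 0)"
  define \<sigma> where "\<sigma> = (\<lambda>i\<in>{..<k}. ((- 1) ^ i * int (k - 1 choose i), b i))"
  have k: "{..<k} = {..k - 1}"
    using ge4 by auto
  have "\<sigma> i \<in> freqs k" if "i < k" for i
  proof -
    have "i = 0 \<or> i = 1 \<or> i = k - 2 \<or> i = k - 1 \<or> 2 \<le> i \<and> i \<le> k - 3 \<and> i \<noteq> k - 2"
      using that by linarith
    then consider "i = 0" | "i = 1" | "i = k - 2" | "i = k - 1" | "i \<in> {2..k - 3}" "i \<noteq> k - 2"
      by auto
    then show ?thesis
    proof cases
      case 5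
      then have "\<sigma> i = ((- 1) ^ i * int (k - 1 choose i), 0)"
        using that by (auto simp: \<sigma>_def b_def)
      moreover have "(int (k - 1 choose i), 0) \<in> pos_freqs k"
        using 5 by (auto simp: pos_freqs_def)
      ultimately show ?thesis
        unfolding freqs_def by (cases "Parity.even i") (force simp: image_iff)+
    next
      case 1
      then show ?thesis
        using ge4 by (auto simp: \<sigma>_def b_def freqs_def pos_freqs_def)
    next
      case 2
      then have "\<sigma> i = - (int k - 1, int k - 2)"
        using ge4 by (auto simp: \<sigma>_def b_def of_nat_diff)
      then show ?thesis
        unfolding freqs_def pos_freqs_def by blast
    next
      case 3
      then have "\<sigma> i = (int k - 1, 1)"
        using ge4 even choose_k_minus_2 by (auto simp: \<sigma>_def b_def of_nat_diff)
      then show ?thesis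
        unfolding freqs_def pos_freqs_def by blast
    next
      case 4
      then have "\<sigma> i = - (1, 0)"
        using ge4 even by (auto simp: \<sigma>_def b_def)
      then show ?thesis
        unfolding freqs_def pos_freqs_def by blast
    qed
  qed
  moreover have "(\<Sum>i<k. snd (\<sigma> i)) = 0" "(\<Sum>i<k. snd (\<sigma> i) * int i) = 0"
    using sum_end_indices[of "\<lambda>i. snd (\<sigma> i)"] sum_end_indices[of "\<lambda>i. snd (\<sigma> i) * int i"] ge4
    by (auto simp: \<sigma>_def b_def of_nat_diff)
  moreover have "(\<Sum>i<k. fst (\<sigma> i) * int i ^ m) = 0" if "m \<le> k - 2" for m
    using sum_alternating_binomial_power[of m "k - 1"] that ge4 by (simp add: \<sigma>_def k)
  ultimately show ?thesis
    using ge4 by (intro bexI[of _ \<sigma>]) (auto simp: ap_relation_def \<sigma>_def zero_prod_def)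
qed

text \<open>The limit along the primes of the progression density of the perturbed constant: by
  \<open>phase_ap_average\<close> only the cancelling tuples survive.\<close>

definition limit_density :: "real \<Rightarrow> real" where
  "limit_density \<epsilon> = (\<Sum>\<sigma>\<in>{..<k} \<rightarrow>\<^sub>E freqs k.
     (\<Prod>i<k. weight k \<epsilon> (\<sigma> i)) * of_bool (ap_relation (k - 2) k \<sigma>))"

lemma limit_density_le:
  assumes "\<epsilon> \<ge> 0"
  shows "limit_density \<epsilon> \<le> (1 / 2) ^ k - \<epsilon> ^ k"
proof -
  let ?S = "{..<k} \<rightarrow>\<^sub>E freqs k"
  let ?w = "\<lambda>\<sigma>. (\<Prod>i<k. weight k \<epsilon> (\<sigma> i)) * of_bool (ap_relation (k - 2) k \<sigma>)"
  define \<sigma>0 :: "nat \<Rightarrow> int \<times> int" where "\<sigma>0 = (\<lambda>i\<in>{..<k}. 0)"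
  obtain \<sigma>1 where \<sigma>1: "\<sigma>1 \<in> ?S" "ap_relation (k - 2) k \<sigma>1" "\<sigma>1 0 \<noteq> 0"
    using ex_ap_relation by blast
  have fin: "finite ?S"
    by (intro finite_PiE finite_freqs) auto
  have \<sigma>0: "\<sigma>0 \<in> ?S" "?w \<sigma>0 = (1 / 2) ^ k"
    by (auto simp: \<sigma>0_def freqs_def ap_relation_def weight_def)
  have ne: "\<sigma>1 \<noteq> \<sigma>0"
    using \<sigma>1(3) ge4 unfolding \<sigma>0_def by force
  have w: "?w \<sigma> = - (\<epsilon> ^ k)" if "\<sigma> \<in> ?S - {\<sigma>0}" "ap_relation (k - 2) k \<sigma>" for \<sigma>
  proof -
    have "\<sigma> \<noteq> \<sigma>0"
      using that by blast
    then obtain l where "\<sigma> l \<noteq> \<sigma>0 l"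
      by (auto simp: fun_eq_iff)
    then have "l < k" "\<sigma> l \<noteq> 0"
      using that by (auto simp: \<sigma>0_def PiE_def extensional_def split: if_splits)
    then show ?thesis
      using prod_weight_ap_relation[of \<sigma> l \<epsilon>] that by auto
  qed
  have w0: "?w \<sigma> \<le> 0" if "\<sigma> \<in> ?S - {\<sigma>0}" for \<sigma>
    using w[OF that] assms by (cases "ap_relation (k - 2) k \<sigma>") auto
  have "limit_density \<epsilon> = ?w \<sigma>0 + (\<Sum>\<sigma>\<in>?S - {\<sigma>0}. ?w \<sigma>)"
    unfolding limit_density_def by (rule sum.remove[OF fin \<sigma>0(1)])
  also have "(\<Sum>\<sigma>\<in>?S - {\<sigma>0}. ?w \<sigma>) = ?w \<sigma>1 + (\<Sum>\<sigma>\<in>?S - {\<sigma>0} - {\<sigma>1}. ?w \<sigma>)"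
    by (rule sum.remove) (use fin \<sigma>1(1) ne in auto)
  also have "?w \<sigma>0 + (?w \<sigma>1 + (\<Sum>\<sigma>\<in>?S - {\<sigma>0} - {\<sigma>1}. ?w \<sigma>)) \<le> (1 / 2) ^ k + (- (\<epsilon> ^ k) + 0)"
    using w[of \<sigma>1] \<sigma>1 ne \<sigma>0(2) w0 by (intro add_mono sum_nonpos) auto
  finally show ?thesis
    by simp
qed

end

section \<open>Rounding a function to a set\<close>

definition multiaffine :: "((nat \<Rightarrow> real) \<Rightarrow> real) \<Rightarrow> bool" where
  "multiaffine \<Phi> \<longleftrightarrow> (\<forall>u x t. \<Phi> (u(x := t)) = (1 - t) * \<Phi> (u(x := 0)) + t * \<Phi> (u(x := 1)))"

lemma multiaffineI:
  "(\<And>u x t. \<Phi> (u(x := t)) = (1 - t) * \<Phi> (u(x := 0)) + t * \<Phi> (u(x := 1))) \<Longrightarrow> multiaffine \<Phi>"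
  unfolding multiaffine_def by blast

lemma multiaffineD:
  "multiaffine \<Phi> \<Longrightarrow> \<Phi> (u(x := t)) = (1 - t) * \<Phi> (u(x := 0)) + t * \<Phi> (u(x := 1))"
  unfolding multiaffine_def by blast

lemma multiaffine_sum:
  assumes "\<And>j. j \<in> J \<Longrightarrow> multiaffine (\<Phi> j)"
  shows "multiaffine (\<lambda>u. \<Sum>j\<in>J. \<Phi> j u)"
proof (rule multiaffineI)
  fix u x t
  have "(\<Sum>j\<in>J. \<Phi> j (u(x := t))) = (\<Sum>j\<in>J. (1 - t) * \<Phi> j (u(x := 0)) + t * \<Phi> j (u(x := 1)))"
    by (intro sum.cong refl multiaffineD assms)
  then show "(\<Sum>j\<in>J. \<Phi> j (u(x := t))) = (1 - t) * (\<Sum>j\<in>J. \<Phi> j (u(x := 0))) + t * (\<Sum>j\<in>J. \<Phi> j (u(x := 1)))"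
    by (simp only: sum.distrib sum_distrib_left)
qed

lemma multiaffine_add:
  assumes "multiaffine \<Phi>" "multiaffine \<Psi>"
  shows "multiaffine (\<lambda>u. \<Phi> u + \<Psi> u)"
proof (rule multiaffineI)
  fix u x t
  show "\<Phi> (u(x := t)) + \<Psi> (u(x := t)) =
      (1 - t) * (\<Phi> (u(x := 0)) + \<Psi> (u(x := 0))) + t * (\<Phi> (u(x := 1)) + \<Psi> (u(x := 1)))"
    unfolding multiaffineD[OF assms(1), of u x t] multiaffineD[OF assms(2), of u x t] by (simp add: distrib_left)
qed

lemma multiaffine_cmult:
  assumes "multiaffine \<Phi>"
  shows "multiaffine (\<lambda>u. c * \<Phi> u)"
proof (rule multiaffineI)
  fix u x t
  show "c * \<Phi> (u(x := t)) = (1 - t) * (c * \<Phi> (u(x := 0))) + t * (c * \<Phi> (u(x := 1)))"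
    unfolding multiaffineD[OF assms, of u x t] by (simp add: distrib_left)
qed

text \<open>Injectivity of \<open>y\<close> puts each coordinate into at most one factor; a repeated
  coordinate would make the product quadratic in it.\<close>

lemma multiaffine_prod:
  assumes "finite I" "inj_on y I"
  shows "multiaffine (\<lambda>u. \<Prod>i\<in>I. u (y i) - c)"
proof (rule multiaffineI)
  fix u :: "nat \<Rightarrow> real" and x t
  show "(\<Prod>i\<in>I. (u(x := t)) (y i) - c) =
      (1 - t) * (\<Prod>i\<in>I. (u(x := 0)) (y i) - c) + t * (\<Prod>i\<in>I. (u(x := 1)) (y i) - c)"
  proof (cases "x \<in> y ` I")
    case True
    then obtain l where l: "l \<in> I" "x = y l"
      by blast
    have F: "(\<Prod>i\<in>I. (u(x := b)) (y i) - c) = (b - c) * (\<Prod>i\<in>I - {l}. u (y i) - c)" for b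
    proof -
      have "y i \<noteq> x" if "i \<in> I - {l}" for i
        using that l assms(2) by (auto dest: inj_onD)
      then show ?thesis
        using assms(1) l by (simp add: prod.remove)
    qed
    show ?thesis
      unfolding F by (simp add: algebra_simps)
  next
    case False
    have F: "(\<Prod>i\<in>I. (u(x := b)) (y i) - c) = (\<Prod>i\<in>I. u (y i) - c)" for b
      using False by (intro prod.cong) auto
    show ?thesis
      unfolding F by (simp add: algebra_simps)
  qed
qed

text \<open>This replaces the choice of a random set that contains each \<open>x\<close> with probability \<open>u x\<close>.\<close>

lemma multiaffine_rounding:
  assumes "multiaffine \<Phi>" "finite X" "\<And>x. x \<in> X \<Longrightarrow> 0 \<le> u x \<and> u x \<le> 1"
  shows "\<exists>A\<subseteq>X. \<Phi> (\<lambda>x. if x \<in> X then indicator A x else u x) \<le> \<Phi> u"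
  using assms(2,3)
proof (induction X)
  case (insert x X)
  then obtain A where A: "A \<subseteq> X" "\<Phi> (\<lambda>z. if z \<in> X then indicator A z else u z) \<le> \<Phi> u"
    by auto
  define v where "v = (\<lambda>z. if z \<in> X then indicator A z else u z)"
  have "v x = u x"
    using insert by (simp add: v_def)
  \<comment> \<open>Method of conditional expectations: \<open>\<Phi> v\<close> is a convex
    combination of the values after setting coordinate \<open>x\<close> to 0 or 1, so one of the two
    choices does not increase it.\<close>
  then have "\<Phi> v = (1 - u x) * \<Phi> (v(x := 0)) + u x * \<Phi> (v(x := 1))"
    using multiaffineD[OF assms(1), of v x "u x"] by (metis fun_upd_triv)
  moreover have "0 \<le> u x" "u x \<le> 1"
    using insert.prems by auto
  then have "(1 - u x) * m + u x * m \<le> (1 - u x) * \<Phi> (v(x := 0)) + u x * \<Phi> (v(x := 1))"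
    if "m = min (\<Phi> (v(x := 0))) (\<Phi> (v(x := 1)))" for m
    unfolding that by (intro add_mono mult_left_mono) auto
  ultimately have "min (\<Phi> (v(x := 0))) (\<Phi> (v(x := 1))) \<le> \<Phi> v"
    by (simp add: algebra_simps)
  then consider "\<Phi> (v(x := 0)) \<le> \<Phi> u" | "\<Phi> (v(x := 1)) \<le> \<Phi> u"
    using A(2) unfolding v_def by linarith
  then show ?case
  proof cases
    case 1
    moreover have "v(x := 0) = (\<lambda>z. if z \<in> insert x X then indicator A z else u z)"
      using insert A by (auto simp: v_def fun_eq_iff indicator_def)
    ultimately show ?thesis
      using A by auto
  next
    case 2
    moreover have "v(x := 1) = (\<lambda>z. if z \<in> insert x X then indicator (insert x A) z else u z)"
      using insert A by (auto simp: v_def fun_eq_iff indicator_def)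
    ultimately show ?thesis
      using A by (intro exI[of _ "insert x A"]) auto
  qed
qed auto

section \<open>Gowers sums and their nondegenerate part\<close>

definition gowers_sum :: "nat \<Rightarrow> nat \<Rightarrow> (nat \<Rightarrow> real) \<Rightarrow> real" where
  "gowers_sum s N f = (\<Sum>x<N. \<Sum>h\<in>{..<s} \<rightarrow>\<^sub>E {..<N}.
     \<Prod>\<omega>\<in>{..<s} \<rightarrow>\<^sub>E {0, 1}. f ((x + (\<Sum>i<s. \<omega> i * h i)) mod N))"

lemma gowers_norm_eq: "gowers_norm s N f = root (2 ^ s) (gowers_sum s N f / real N ^ (s + 1))"
  by (simp add: gowers_norm_def gowers_sum_def)

lemma gowers_sum_eq_cube:
  "gowers_sum s N f = (\<Sum>h\<in>{..<s} \<rightarrow>\<^sub>E {..<N}. \<Sum>x<N. cube s (\<lambda>x. f (x mod N)) (\<lambda>x. f (x mod N)) h x)"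
  unfolding gowers_sum_def prod_cube[symmetric] by (rule sum.swap)

lemma gowers_sum_nonneg: "s > 0 \<Longrightarrow> gowers_sum s N f \<ge> 0"
  unfolding gowers_sum_eq_cube by (intro sum_cube_nonneg) auto

text \<open>Lets the case \<open>s = 1\<close> measure how far the mean is from the prescribed one,
  so that the density of the set is controlled by the same rounding argument as its
  uniformity.\<close>

lemma gowers_sum_1: "gowers_sum 1 N f = (\<Sum>x<N. f x)\<^sup>2"
proof -
  have "(\<Sum>x<N. f (x mod N)) = (\<Sum>x<N. f x)"
    by (intro sum.cong) auto
  then show ?thesis
    using sum_cube_Suc[of "\<lambda>x. f (x mod N)" N 0 "\<lambda>x. f (x mod N)"]
    by (simp add: gowers_sum_eq_cube power2_eq_square)
qed

text \<open>The Gowers sum becomes multiaffine once the cubes with coinciding vertices are omitted.\<close>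

definition nondegenerate_edges :: "nat \<Rightarrow> nat \<Rightarrow> (nat \<Rightarrow> nat) set" where
  "nondegenerate_edges s N = {h \<in> {..<s} \<rightarrow>\<^sub>E {..<N}. inj_on (\<lambda>\<omega>. (\<Sum>i<s. \<omega> i * h i) mod N) ({..<s} \<rightarrow>\<^sub>E {0, 1})}"

definition gowers_sum_off :: "nat \<Rightarrow> nat \<Rightarrow> (nat \<Rightarrow> real) \<Rightarrow> real" where
  "gowers_sum_off s N f = (\<Sum>x<N. \<Sum>h\<in>nondegenerate_edges s N.
     \<Prod>\<omega>\<in>{..<s} \<rightarrow>\<^sub>E {0, 1}. f ((x + (\<Sum>i<s. \<omega> i * h i)) mod N))"

text \<open>At a coordinate \<open>l\<close> where the two vertices differ, \<open>h l\<close>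
  enters the congruence with coefficient 1 or -1 and is determined by the other edges.\<close>

lemma card_coincident_edges_le:
  assumes "prime N" "\<omega> \<in> {..<s} \<rightarrow>\<^sub>E {0, 1}" "\<omega>' \<in> {..<s} \<rightarrow>\<^sub>E {0, 1}" "\<omega> \<noteq> \<omega>'"
  shows "card {h \<in> {..<s} \<rightarrow>\<^sub>E {..<N}. (\<Sum>i<s. \<omega> i * h i) mod N = (\<Sum>i<s. \<omega>' i * h i) mod N} \<le> N ^ (s - 1)"
    (is "card ?B \<le> _")
proof -
  obtain l where l: "l < s" "\<omega> l \<noteq> \<omega>' l"
    using PiE_ext[OF assms(2,3)] assms(4) by auto
  have "inj_on (\<lambda>h. restrict h ({..<s} - {l})) ?B"
  proof (rule inj_onI)
    fix h h'
    assume hh: "h \<in> ?B" "h' \<in> ?B" and eq: "restrict h ({..<s} - {l}) = restrict h' ({..<s} - {l})"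
    have same: "h i = h' i" if "i < s" "i \<noteq> l" for i
      using fun_cong[OF eq, of i] that by auto
    define R where "R = (\<lambda>h. \<Sum>i\<in>{..<s} - {l}. (int (\<omega> i) - int (\<omega>' i)) * int (h i))"
    have dvd: "int N dvd R g + (int (\<omega> l) - int (\<omega>' l)) * int (g l)" if "g \<in> ?B" for g
    proof -
      have "R g + (int (\<omega> l) - int (\<omega>' l)) * int (g l) = (\<Sum>i<s. (int (\<omega> i) - int (\<omega>' i)) * int (g i))"
        using l by (simp add: R_def sum.remove[of "{..<s}" l])
      also have "\<dots> = int (\<Sum>i<s. \<omega> i * g i) - int (\<Sum>i<s. \<omega>' i * g i)"
        by (simp add: left_diff_distrib sum_subtractf)
      also have "int N dvd \<dots>"
        using that by (simp only: mod_eq_dvd_iff[symmetric] zmod_int[symmetric] mem_Collect_eq)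
      finally show ?thesis .
    qed
    have "R h = R h'"
      unfolding R_def using same by (intro sum.cong) auto
    then have "int N dvd (int (\<omega> l) - int (\<omega>' l)) * (int (h l) - int (h' l))"
      using dvd_diff[OF dvd[OF hh(1)] dvd[OF hh(2)]] by (simp add: algebra_simps)
    moreover have "int (\<omega> l) - int (\<omega>' l) \<in> {1, - 1}"
    proof -
      have "\<omega> l \<in> {0, 1}" "\<omega>' l \<in> {0, 1}"
        using assms(2,3) l by auto
      then show ?thesis
        using l by auto
    qed
    ultimately have "int N dvd int (h l) - int (h' l)"
      by (auto simp: dvd_diff_commute)
    then have "int (h l) mod int N = int (h' l) mod int N"
      by (simp add: mod_eq_dvd_iff)
    moreover have "h l < N" "h' l < N"
      using hh l by auto
    ultimately have "h l = h' l"
      by simp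
    then show "h = h'"
      using hh same by (intro PiE_ext[of h "{..<s}" "\<lambda>_. {..<N}" h']) auto
  qed
  moreover have "(\<lambda>h. restrict h ({..<s} - {l})) ` ?B \<subseteq> ({..<s} - {l}) \<rightarrow>\<^sub>E {..<N}"
  proof (rule image_subsetI)
    fix h
    assume "h \<in> ?B"
    then have "h \<in> {..<s} \<rightarrow>\<^sub>E {..<N}"
      by blast
    then show "restrict h ({..<s} - {l}) \<in> ({..<s} - {l}) \<rightarrow>\<^sub>E {..<N}"
      by (intro restrict_PiE_iff[THEN iffD2]) auto
  qed
  ultimately have "card ?B \<le> card (({..<s} - {l}) \<rightarrow>\<^sub>E {..<N})"
    by (rule card_inj_on_le) (simp add: finite_PiE)
  then show ?thesis
    using l by (simp add: card_PiE)
qed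

text \<open>A union bound; \<open>4 ^ s\<close> counts the ordered pairs of vertices.\<close>

lemma card_degenerate_edges_le:
  assumes "prime N"
  shows "card (({..<s} \<rightarrow>\<^sub>E {..<N}) - nondegenerate_edges s N) \<le> 4 ^ s * N ^ (s - 1)"
proof -
  let ?\<Omega> = "{..<s} \<rightarrow>\<^sub>E {0, 1 :: nat}"
  let ?B = "\<lambda>(\<omega>, \<omega>'). {h \<in> {..<s} \<rightarrow>\<^sub>E {..<N}. (\<Sum>i<s. \<omega> i * h i) mod N = (\<Sum>i<s. \<omega>' i * h i) mod N}"
  let ?P = "{p \<in> ?\<Omega> \<times> ?\<Omega>. fst p \<noteq> snd p}"
  have fin: "finite ?\<Omega>" "card ?\<Omega> = 2 ^ s" "finite ({..<s} \<rightarrow>\<^sub>E {..<N})"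
    by (simp_all add: finite_PiE card_PiE numeral_2_eq_2)
  have "({..<s} \<rightarrow>\<^sub>E {..<N}) - nondegenerate_edges s N \<subseteq> (\<Union>p\<in>?P. ?B p)"
  proof
    fix h
    assume h: "h \<in> ({..<s} \<rightarrow>\<^sub>E {..<N}) - nondegenerate_edges s N"
    then obtain \<omega> \<omega>' where "\<omega> \<in> ?\<Omega>" "\<omega>' \<in> ?\<Omega>" "\<omega> \<noteq> \<omega>'"
      and "(\<Sum>i<s. \<omega> i * h i) mod N = (\<Sum>i<s. \<omega>' i * h i) mod N"
      unfolding nondegenerate_edges_def inj_on_def by blast
    then show "h \<in> (\<Union>p\<in>?P. ?B p)"
      using h by (intro UN_I[of "(\<omega>, \<omega>')"]) simp_all
  qed
  then have "card (({..<s} \<rightarrow>\<^sub>E {..<N}) - nondegenerate_edges s N) \<le> card (\<Union>p\<in>?P. ?B p)"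
    using fin by (intro card_mono) auto
  also have "\<dots> \<le> (\<Sum>p\<in>?P. card (?B p))"
    using fin by (intro card_UN_le) auto
  also have "\<dots> \<le> (\<Sum>p\<in>?P. N ^ (s - 1))"
    using card_coincident_edges_le[OF assms] by (intro sum_mono) auto
  also have "\<dots> \<le> card (?\<Omega> \<times> ?\<Omega>) * N ^ (s - 1)"
  proof -
    have "card ?P \<le> card (?\<Omega> \<times> ?\<Omega>)"
      using fin by (intro card_mono) auto
    then show ?thesis
      by simp
  qed
  also have "card (?\<Omega> \<times> ?\<Omega>) = 4 ^ s"
    using fin by (simp add: card_cartesian_product flip: power_mult_distrib)
  finally show ?thesis .
qed

lemma gowers_sum_off_diff_le:
  assumes "prime N" "s > 0" "\<And>x. x < N \<Longrightarrow> \<bar>f x\<bar> \<le> 1"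
  shows "\<bar>gowers_sum s N f - gowers_sum_off s N f\<bar> \<le> 4 ^ s * real N ^ s"
proof -
  let ?H = "{..<s} \<rightarrow>\<^sub>E {..<N}"
  let ?F = "\<lambda>x h. \<Prod>\<omega>\<in>{..<s} \<rightarrow>\<^sub>E {0, 1}. f ((x + (\<Sum>i<s. \<omega> i * h i)) mod N)"
  have N: "N > 0"
    using assms(1) prime_gt_0_nat by blast
  have sub: "nondegenerate_edges s N \<subseteq> ?H" and fin: "finite ?H"
    by (auto simp: nondegenerate_edges_def intro!: finite_PiE)
  have F1: "\<bar>?F x h\<bar> \<le> 1" for x h
    unfolding abs_prod using assms(3) N by (intro prod_le_1) auto
  have "gowers_sum s N f - gowers_sum_off s N f = (\<Sum>x<N. \<Sum>h\<in>?H - nondegenerate_edges s N. ?F x h)"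
    unfolding gowers_sum_def gowers_sum_off_def sum_subtractf[symmetric] sum_diff[OF fin sub] ..
  also have "\<bar>\<dots>\<bar> \<le> (\<Sum>x<N. \<Sum>h\<in>?H - nondegenerate_edges s N. 1)"
    by (intro order.trans[OF sum_abs] sum_mono F1)
  also have "\<dots> = real (N * card (?H - nondegenerate_edges s N))"
    by simp
  also have "\<dots> \<le> real (N * (4 ^ s * N ^ (s - 1)))"
    using card_degenerate_edges_le[OF assms(1), of s] by (intro of_nat_mono mult_le_mono2)
  also have "\<dots> = 4 ^ s * real N ^ s"
    using assms(2) by (cases s) auto
  finally show ?thesis .
qed

lemma multiaffine_gowers_sum_off: "multiaffine (\<lambda>u. gowers_sum_off s N (\<lambda>x. u x - c))"
  unfolding gowers_sum_off_def
proof (rule multiaffine_sum, rule multiaffine_sum, rule multiaffine_prod)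
  show "finite ({..<s} \<rightarrow>\<^sub>E {0, 1 :: nat})"
    by (simp add: finite_PiE)
  fix x h
  assume h: "h \<in> nondegenerate_edges s N"
  show "inj_on (\<lambda>\<omega>. (x + (\<Sum>i<s. \<omega> i * h i)) mod N) ({..<s} \<rightarrow>\<^sub>E {0, 1})"
  proof (rule inj_onI)
    fix \<omega> \<omega>'
    assume \<omega>: "\<omega> \<in> {..<s} \<rightarrow>\<^sub>E {0, 1}" "\<omega>' \<in> {..<s} \<rightarrow>\<^sub>E {0, 1}"
      and "(x + (\<Sum>i<s. \<omega> i * h i)) mod N = (x + (\<Sum>i<s. \<omega>' i * h i)) mod N"
    then have "[x + (\<Sum>i<s. \<omega> i * h i) = x + (\<Sum>i<s. \<omega>' i * h i)] (mod N)"
      by (simp only: cong_def)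
    then have "[(\<Sum>i<s. \<omega> i * h i) = (\<Sum>i<s. \<omega>' i * h i)] (mod N)"
      by (simp only: cong_add_lcancel_nat)
    then have "(\<Sum>i<s. \<omega> i * h i) mod N = (\<Sum>i<s. \<omega>' i * h i) mod N"
      by (simp only: cong_def)
    then show "\<omega> = \<omega>'"
      using h \<omega> by (auto simp: nondegenerate_edges_def dest: inj_onD)
  qed
qed

definition ap_sum :: "nat \<Rightarrow> nat \<Rightarrow> (nat \<Rightarrow> real) \<Rightarrow> real" where
  "ap_sum k N f = (\<Sum>x<N. \<Sum>d<N. \<Prod>i<k. f ((x + i * d) mod N))"

text \<open>Modulo a prime \<open>N \<ge> k\<close> the terms of a progression coincide only when
  \<open>d = 0\<close>.\<close>

definition ap_sum_off :: "nat \<Rightarrow> nat \<Rightarrow> (nat \<Rightarrow> real) \<Rightarrow> real" where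
  "ap_sum_off k N f = (\<Sum>x<N. \<Sum>d\<in>{..<N} - {0}. \<Prod>i<k. f ((x + i * d) mod N))"

lemma ap_density_eq: "ap_density k N A = ap_sum k N (indicator A) / real N ^ 2"
proof -
  have "(\<Prod>i<k. indicator A ((x + i * d) mod N)) = (of_bool (\<forall>i<k. (x + i * d) mod N \<in> A) :: real)" for x d
  proof (cases "\<forall>i<k. (x + i * d) mod N \<in> A")
    case True
    then show ?thesis
      by (simp add: indicator_def)
  next
    case False
    then obtain i where "i < k" "(x + i * d) mod N \<notin> A"
      by blast
    then show ?thesis
      using False by (subst prod_zero) (auto simp: indicator_def)
  qed
  then have "ap_sum k N (indicator A) = (\<Sum>x<N. \<Sum>d<N. of_bool (\<forall>i<k. (x + i * d) mod N \<in> A))"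
    by (simp only: ap_sum_def)
  also have "\<dots> = real (card {p \<in> {..<N} \<times> {..<N}. \<forall>i<k. (fst p + i * snd p) mod N \<in> A})"
    unfolding sum.cartesian_product by (simp add: case_prod_unfold Int_def)
  finally have "ap_sum k N (indicator A) = \<dots>" .
  moreover have "{p \<in> {..<N} \<times> {..<N}. \<forall>i<k. (fst p + i * snd p) mod N \<in> A} =
      {(x, d). x < N \<and> d < N \<and> (\<forall>i<k. (x + i * d) mod N \<in> A)}"
    by auto
  ultimately show ?thesis
    by (simp add: ap_density_def)
qed

lemma ap_sum_off_bounds:
  assumes "\<And>x. x < N \<Longrightarrow> 0 \<le> f x \<and> f x \<le> 1" "N > 0"
  shows "ap_sum_off k N f \<le> ap_sum k N f" "ap_sum k N f \<le> ap_sum_off k N f + N"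
proof -
  have eq: "ap_sum k N f = ap_sum_off k N f + (\<Sum>x<N. \<Prod>i<k. f (x mod N))"
    unfolding ap_sum_def ap_sum_off_def using assms(2) by (simp add: sum.remove[of "{..<N}" 0] sum.distrib)
  have b: "0 \<le> (\<Prod>i<k. f (x mod N))" "(\<Prod>i<k. f (x mod N)) \<le> 1" for x
    using assms by (auto intro!: power_le_one)
  have "0 \<le> (\<Sum>x<N. \<Prod>i<k. f (x mod N))" "(\<Sum>x<N. \<Prod>i<k. f (x mod N)) \<le> (\<Sum>x<N. 1)"
    by (rule sum_nonneg, rule b) (rule sum_mono, rule b)
  then show "ap_sum_off k N f \<le> ap_sum k N f" "ap_sum k N f \<le> ap_sum_off k N f + N"
    unfolding eq by auto
qed

lemma multiaffine_ap_sum_off: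
  assumes "prime N" "k \<le> N"
  shows "multiaffine (ap_sum_off k N)"
proof -
  have "multiaffine (\<lambda>u. \<Sum>x<N. \<Sum>d\<in>{..<N} - {0}. \<Prod>i<k. u ((x + i * d) mod N) - 0)"
  proof (rule multiaffine_sum, rule multiaffine_sum, rule multiaffine_prod)
    show "finite {..<k}"
      by simp
    fix x d
    assume d: "d \<in> {..<N} - {0}"
    show "inj_on (\<lambda>i. (x + i * d) mod N) {..<k}"
    proof (rule inj_onI)
      fix i j
      assume ij: "i \<in> {..<k}" "j \<in> {..<k}" and "(x + i * d) mod N = (x + j * d) mod N"
      then have "[x + i * d = x + j * d] (mod N)"
        by (simp only: cong_def)
      then have "[i * d = j * d] (mod N)"
        by (simp only: cong_add_lcancel_nat)
      moreover have "coprime d N"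
        using d assms(1) prime_imp_coprime_nat[of N d] by (auto simp: coprime_commute dest: nat_dvd_not_less)
      ultimately have "[i = j] (mod N)"
        using cong_mult_rcancel_nat by blast
      then show "i = j"
        using ij assms by (simp add: cong_def)
    qed
  qed
  then show ?thesis
    unfolding ap_sum_off_def by simp
qed

text \<open>One set must have few progressions, be uniform and have the right density, so a single
  weighted sum of the three quantities is rounded. It can be split afterwards because none of its
  terms is negative.\<close>

lemma exists_rounded_set:
  assumes "prime N" "k \<le> N" "s > 0" "M \<ge> 0" and f: "\<And>x. 0 \<le> f x \<and> f x \<le> 1" and c: "0 \<le> c" "c \<le> 1"
  shows "\<exists>A\<subseteq>{..<N}. ap_density k N A + M * (gowers_sum s N (\<lambda>x. indicator A x - c) / real N ^ (s + 1)
      + gowers_sum 1 N (\<lambda>x. indicator A x - c) / real N ^ 2)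
    \<le> ap_sum k N f / real N ^ 2 + M * (gowers_sum s N (\<lambda>x. f x - c) / real N ^ (s + 1)
      + gowers_sum 1 N (\<lambda>x. f x - c) / real N ^ 2) + (1 + M * (2 * 4 ^ s + 8)) / real N"
proof -
  have N: "N > 0"
    using assms(1) prime_gt_0_nat by blast
  define \<Phi> where "\<Phi> = (\<lambda>u. ap_sum_off k N u / real N ^ 2 + M * (gowers_sum_off s N (\<lambda>x. u x - c) / real N ^ (s + 1)
      + gowers_sum_off 1 N (\<lambda>x. u x - c) / real N ^ 2))"
  have "multiaffine (\<lambda>u. 1 / real N ^ 2 * ap_sum_off k N u + M * (1 / real N ^ (s + 1) * gowers_sum_off s N (\<lambda>x. u x - c)
      + 1 / real N ^ 2 * gowers_sum_off 1 N (\<lambda>x. u x - c)))"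
    by (intro multiaffine_add multiaffine_cmult multiaffine_gowers_sum_off multiaffine_ap_sum_off assms)
  then have "multiaffine \<Phi>"
    by (simp add: \<Phi>_def)
  then obtain A where A: "A \<subseteq> {..<N}" "\<Phi> (\<lambda>x. if x \<in> {..<N} then indicator A x else f x) \<le> \<Phi> f"
    using multiaffine_rounding[of \<Phi> "{..<N}" f] f by auto
  have "\<Phi> (\<lambda>x. if x \<in> {..<N} then indicator A x else f x) = \<Phi> (indicator A)"
    unfolding \<Phi>_def ap_sum_off_def gowers_sum_off_def using N by simp
  then have le: "\<Phi> (indicator A) \<le> \<Phi> f"
    using A by simp
  have G: "\<bar>gowers_sum t N (\<lambda>x. u x - c) / real N ^ (t + 1) - gowers_sum_off t N (\<lambda>x. u x - c) / real N ^ (t + 1)\<bar> \<le> 4 ^ t / N"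
    if "t > 0" "\<And>x. x < N \<Longrightarrow> 0 \<le> u x \<and> u x \<le> 1" for t u
  proof -
    have "\<bar>u x - c\<bar> \<le> 1" if "x < N" for x
      using \<open>\<And>x. x < N \<Longrightarrow> 0 \<le> u x \<and> u x \<le> 1\<close>[OF that] c by auto
    then have "\<bar>gowers_sum t N (\<lambda>x. u x - c) - gowers_sum_off t N (\<lambda>x. u x - c)\<bar> \<le> 4 ^ t * real N ^ t"
      using assms(1) that(1) by (intro gowers_sum_off_diff_le) auto
    then have "\<bar>gowers_sum t N (\<lambda>x. u x - c) - gowers_sum_off t N (\<lambda>x. u x - c)\<bar> / real N ^ (t + 1) \<le> 4 ^ t * real N ^ t / real N ^ (t + 1)"
      by (rule divide_right_mono) simp
    then show ?thesis
      using N by (simp add: abs_divide flip: diff_divide_distrib)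
  qed
  have ind: "0 \<le> (indicator A x :: real) \<and> indicator A x \<le> (1 :: real)" for x
    by (simp add: indicator_def)
  \<comment> \<open>The difference 0 costs \<open>1 / N\<close> for the set only: for
    \<open>f\<close> its contribution is nonnegative and may be dropped. The Gowers averages are
    corrected for both functions, which doubles \<open>4 ^ s + 4\<close>.\<close>
  have P: "ap_sum k N (indicator A) / real N ^ 2 \<le> ap_sum_off k N (indicator A) / real N ^ 2 + 1 / N"
    using ap_sum_off_bounds(2)[of N "indicator A" k] ind N by (simp add: field_simps power2_eq_square)
  have Pf: "ap_sum_off k N f / real N ^ 2 \<le> ap_sum k N f / real N ^ 2"
    using ap_sum_off_bounds(1)[of N f k] f N by (intro divide_right_mono) auto
  define g where "g = (\<lambda>u. gowers_sum s N (\<lambda>x. u x - c) / real N ^ (s + 1) + gowers_sum 1 N (\<lambda>x. u x - c) / real N ^ 2)"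
  define g' where "g' = (\<lambda>u. gowers_sum_off s N (\<lambda>x. u x - c) / real N ^ (s + 1) + gowers_sum_off 1 N (\<lambda>x. u x - c) / real N ^ 2)"
  have "\<bar>g u - g' u\<bar> \<le> (4 ^ s + 4) / N" if "\<And>x. x < N \<Longrightarrow> 0 \<le> u x \<and> u x \<le> 1" for u
  proof -
    have G1: "\<bar>gowers_sum 1 N (\<lambda>x. u x - c) / real N ^ 2 - gowers_sum_off 1 N (\<lambda>x. u x - c) / real N ^ 2\<bar> \<le> 4 / N"
      using G[of 1 u] that by (simp only: one_add_one power_one_right zero_less_one simp_thms)
    show ?thesis
      using G[OF assms(3), of u, OF that] G1 unfolding g_def g'_def add_divide_distrib by linarith
  qed
  from this[of "indicator A"] this[of f] have "g (indicator A) - g' (indicator A) + (g' f - g f) \<le> (2 * 4 ^ s + 8) / N"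
    using ind f by (simp add: add_divide_distrib)
  then have "M * (g (indicator A) - g' (indicator A) + (g' f - g f)) \<le> M * ((2 * 4 ^ s + 8) / N)"
    using assms(4) by (rule mult_left_mono)
  then have "M * g (indicator A) + M * g' f \<le> M * g' (indicator A) + M * g f + M * (2 * 4 ^ s + 8) / N"
    by (simp add: algebra_simps)
  moreover have "ap_sum_off k N (indicator A) / real N ^ 2 + M * g' (indicator A) \<le> ap_sum_off k N f / real N ^ 2 + M * g' f"
    using le by (simp add: \<Phi>_def g'_def)
  ultimately have "ap_density k N A + M * g (indicator A) \<le> ap_sum k N f / real N ^ 2 + M * g f + (1 + M * (2 * 4 ^ s + 8)) / N"
    using P Pf unfolding ap_density_eq by (simp add: add_divide_distrib)
  then show ?thesis
    using A(1) unfolding g_def by blast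
qed

section \<open>The uniform sets\<close>

lemma periodic_mod:
  fixes F :: "nat \<Rightarrow> 'a"
  assumes "\<And>x. F (x + N) = F x"
  shows "F (x mod N) = F x"
proof -
  have "F (y + m * N) = F y" for y m
  proof (induction m)
    case (Suc m)
    have "y + Suc m * N = (y + m * N) + N"
      by simp
    then show ?case
      using Suc assms[of "y + m * N"] by (simp only:)
  qed simp
  from this[of "x mod N" "x div N"] show ?thesis
    by (simp only: mod_mult_div_eq mult.commute[of _ N])
qed

lemma phase_uminus: "phase s (- p) x = - phase s p x"
  by (simp add: phase_def)

lemma phase_polyfun:
  assumes "s \<ge> 2"
  shows "phase s p x = (\<Sum>j\<le>s. (if j = s then fst p else if j = 1 then snd p else 0) * int x ^ j)"
proof -
  have "(if j = s then fst p else if j = 1 then snd p else 0) * int x ^ j =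
      (if j = s then fst p * int x ^ s else 0) + (if j = 1 then snd p * int x else 0)" for j
    using assms by auto
  then show ?thesis
    using assms by (simp add: sum.distrib phase_def)
qed

lemma e_mod_phase_periodic:
  assumes "N > 0"
  shows "e_mod N (phase s p (x + N)) = e_mod N (phase s p x)"
proof (rule e_mod_cong[OF assms])
  have "int N dvd int (x + N) ^ s - int x ^ s"
    unfolding power_diff_sumr2 by simp
  then have "int N dvd fst p * (int (x + N) ^ s - int x ^ s) + snd p * int N"
    by simp
  also have "fst p * (int (x + N) ^ s - int x ^ s) + snd p * int N = phase s p (x + N) - phase s p x"
    by (simp add: phase_def algebra_simps)
  finally show "int N dvd phase s p (x + N) - phase s p x" .
qed

context
  fixes k :: nat and \<epsilon> :: real
  assumes even: "even k" and ge4: "k \<ge> 4"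
  defines "\<epsilon> \<equiv> 1 / (2 * real (card (freqs k)))"
begin

text \<open>The sum is real already, by the symmetry of frequencies and weights; \<open>Re\<close>
  only adjusts the type.\<close>

definition approximant :: "nat \<Rightarrow> nat \<Rightarrow> real" where
  "approximant N x = Re (\<Sum>p\<in>freqs k. of_real (weight k \<epsilon> p) * e_mod N (phase (k - 2) p x))"

lemma \<epsilon>_pos: "\<epsilon> > 0"
  using finite_freqs[of k] by (auto simp: \<epsilon>_def card_gt_0_iff freqs_def)

lemma of_real_approximant:
  "complex_of_real (approximant N x) = (\<Sum>p\<in>freqs k. of_real (weight k \<epsilon> p) * e_mod N (phase (k - 2) p x))"
proof -
  let ?S = "\<Sum>p\<in>freqs k. of_real (weight k \<epsilon> p) * e_mod N (phase (k - 2) p x)"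
  have "cnj ?S = (\<Sum>p\<in>freqs k. of_real (weight k \<epsilon> (- p)) * e_mod N (phase (k - 2) (- p) x))"
    by (simp add: cnj_e_mod weight_uminus phase_uminus)
  also have "\<dots> = ?S"
    by (rule sum.reindex_bij_witness[of _ uminus uminus]) (auto simp: uminus_freqs)
  finally show ?thesis
    unfolding approximant_def by (simp only: of_real_Re Reals_cnj_iff)
qed

lemma approximant_diff:
  "complex_of_real (approximant N x - 1 / 2) =
     (\<Sum>p\<in>freqs k - {0}. of_real (weight k \<epsilon> p) * e_mod N (phase (k - 2) p x))"
proof -
  have "0 \<in> freqs k"
    by (simp add: freqs_def)
  then show ?thesis
    using sum.remove[OF finite_freqs, of 0 k "\<lambda>p. of_real (weight k \<epsilon> p) * e_mod N (phase (k - 2) p x)"]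
    by (simp add: of_real_approximant weight_def phase_def)
qed

lemma abs_weight: "p \<noteq> 0 \<Longrightarrow> \<bar>weight k \<epsilon> p\<bar> = \<epsilon>"
  using \<epsilon>_pos by (auto simp: weight_def)

text \<open>This fixes the size of \<open>\<epsilon>\<close>: the nonconstant phases have total
  weight at most \<open>1 / 2\<close>, so the function takes values in the unit interval and can be
  rounded.\<close>

lemma approximant_bounds: "\<bar>approximant N x - 1 / 2\<bar> \<le> 1 / 2"
proof -
  have "\<bar>approximant N x - 1 / 2\<bar> = cmod (complex_of_real (approximant N x - 1 / 2))"
    by (simp only: norm_of_real)
  also have "\<dots> \<le> (\<Sum>p\<in>freqs k - {0}. \<epsilon>)"
    unfolding approximant_diff by (rule sum_norm_le) (simp add: norm_mult abs_weight)
  also have "\<dots> \<le> (\<Sum>p\<in>freqs k. \<epsilon>)"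
    using \<epsilon>_pos by (intro sum_mono2 finite_freqs) auto
  also have "\<dots> = 1 / 2"
    using \<epsilon>_pos by (auto simp: \<epsilon>_def)
  finally show ?thesis .
qed

lemma approximant_periodic: "N > 0 \<Longrightarrow> approximant N (x + N) = approximant N x"
  unfolding approximant_def by (simp add: e_mod_phase_periodic)

lemma approximant_mod: "N > 0 \<Longrightarrow> approximant N (x mod N) = approximant N x"
  by (rule periodic_mod) (rule approximant_periodic)

lemma ap_sum_approximant:
  assumes "N > 0"
  shows "complex_of_real (ap_sum k N (approximant N) / real N ^ 2) =
    (\<Sum>\<sigma>\<in>{..<k} \<rightarrow>\<^sub>E freqs k. of_real (\<Prod>i<k. weight k \<epsilon> (\<sigma> i)) *
      ((\<Sum>x<N. \<Sum>d<N. e_mod N (\<Sum>i<k. phase (k - 2) (\<sigma> i) (x + i * d))) / of_nat N ^ 2))"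
proof -
  have "complex_of_real (\<Prod>i<k. approximant N (x + i * d)) =
      (\<Sum>\<sigma>\<in>{..<k} \<rightarrow>\<^sub>E freqs k. of_real (\<Prod>i<k. weight k \<epsilon> (\<sigma> i)) * e_mod N (\<Sum>i<k. phase (k - 2) (\<sigma> i) (x + i * d)))" for x d
    unfolding of_real_prod of_real_approximant
    by (subst prod_sum_PiE) (simp_all add: finite_freqs prod.distrib e_mod_sum)
  then have "complex_of_real (ap_sum k N (approximant N)) =
    (\<Sum>x<N. \<Sum>d<N. \<Sum>\<sigma>\<in>{..<k} \<rightarrow>\<^sub>E freqs k. of_real (\<Prod>i<k. weight k \<epsilon> (\<sigma> i)) *
      e_mod N (\<Sum>i<k. phase (k - 2) (\<sigma> i) (x + i * d)))"
    unfolding ap_sum_def approximant_mod[OF assms] of_real_sum by (simp only:)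
  also have "\<dots> = (\<Sum>x<N. \<Sum>\<sigma>\<in>{..<k} \<rightarrow>\<^sub>E freqs k. \<Sum>d<N. of_real (\<Prod>i<k. weight k \<epsilon> (\<sigma> i)) *
      e_mod N (\<Sum>i<k. phase (k - 2) (\<sigma> i) (x + i * d)))"
    by (intro sum.cong refl sum.swap)
  also have "\<dots> = (\<Sum>\<sigma>\<in>{..<k} \<rightarrow>\<^sub>E freqs k. of_real (\<Prod>i<k. weight k \<epsilon> (\<sigma> i)) *
      (\<Sum>x<N. \<Sum>d<N. e_mod N (\<Sum>i<k. phase (k - 2) (\<sigma> i) (x + i * d))))"
    by (subst sum.swap) (simp only: sum_distrib_left)
  finally have eq: "complex_of_real (ap_sum k N (approximant N)) = \<dots>" .
  show ?thesis
    unfolding of_real_divide eq by (subst sum_divide_distrib) simp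
qed

lemma ap_sum_tendsto:
  "((\<lambda>N. ap_sum k N (approximant N) / real N ^ 2) \<longlongrightarrow> limit_density k \<epsilon>) primes_at_top"
proof -
  have "((\<lambda>N. \<Sum>\<sigma>\<in>{..<k} \<rightarrow>\<^sub>E freqs k. complex_of_real (\<Prod>i<k. weight k \<epsilon> (\<sigma> i)) *
      ((\<Sum>x<N. \<Sum>d<N. e_mod N (\<Sum>i<k. phase (k - 2) (\<sigma> i) (x + i * d))) / of_nat N ^ 2))
    \<longlongrightarrow> (\<Sum>\<sigma>\<in>{..<k} \<rightarrow>\<^sub>E freqs k. complex_of_real (\<Prod>i<k. weight k \<epsilon> (\<sigma> i)) *
      of_bool (ap_relation (k - 2) k \<sigma>))) primes_at_top"
    using ge4 by (intro tendsto_sum tendsto_mult_left phase_ap_average) auto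
  also have "(\<Sum>\<sigma>\<in>{..<k} \<rightarrow>\<^sub>E freqs k. complex_of_real (\<Prod>i<k. weight k \<epsilon> (\<sigma> i)) *
      of_bool (ap_relation (k - 2) k \<sigma>)) = complex_of_real (limit_density k \<epsilon>)"
    unfolding limit_density_def[OF even ge4] of_real_sum of_real_mult by (intro sum.cong refl) auto
  finally have "((\<lambda>N. complex_of_real (ap_sum k N (approximant N) / real N ^ 2)) \<longlongrightarrow>
      complex_of_real (limit_density k \<epsilon>)) primes_at_top"
    by (rule Lim_transform_eventually)
      (rule eventually_mono[OF eventually_prime_primes_at_top[of 0]], rule ap_sum_approximant[symmetric], simp)
  then show ?thesis
    by (simp only: tendsto_of_real_iff)
qed

lemma eventually_fst_freqs:
  "\<forall>\<^sub>F N in primes_at_top. prime N \<and> k < N \<and> (\<forall>p\<in>freqs k - {0}. \<not> int N dvd fst p)"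
proof -
  have "\<forall>\<^sub>F N in primes_at_top. \<forall>p\<in>freqs k - {0}. \<not> int N dvd fst p"
    using freqs_fst_0[OF even ge4] finite_freqs
    by (intro eventually_ball_finite) (auto intro!: eventually_not_dvd_primes_at_top)
  with eventually_prime_primes_at_top[of k] show ?thesis
    by eventually_elim auto
qed

text \<open>Only the separated vertex is expanded into phases. The remaining vertices keep the whole
  perturbation, which is periodic and bounded by 1, so each phase is handled by one Weyl
  estimate.\<close>

lemma gowers_sum_approximant_le:
  assumes "prime N" "k < N" "\<And>p. p \<in> freqs k - {0} \<Longrightarrow> \<not> int N dvd fst p"
  shows "gowers_sum (k - 2) N (\<lambda>x. approximant N x - 1 / 2) / real N ^ (k - 1) \<le> card (freqs k) * \<epsilon> * weyl_err N (k - 2)"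
proof -
  \<comment> \<open>Then the degree \<open>k - 2\<close> is \<open>Suc s\<close> and the exponent
    \<open>k - 1\<close> is \<open>s + 2\<close>, as in \<open>norm_sum_cube_le\<close>.\<close>
  obtain s where s: "k = Suc (Suc (Suc s))"
    using ge4 that[of "k - 3"] by simp
  have N: "N > 0"
    using assms by simp
  define g where "g = (\<lambda>x. complex_of_real (approximant N x - 1 / 2))"
  have g: "g (x + N) = g x" "cmod (g x) \<le> 1" for x
    using approximant_bounds[of N x] N unfolding g_def norm_of_real by (auto simp: approximant_periodic)
  have term_le: "cmod (\<Sum>h\<in>{..<k - 2} \<rightarrow>\<^sub>E {..<N}. \<Sum>x<N. cube (k - 2) (\<lambda>x. e_mod N (phase (k - 2) p x)) g h x)
      \<le> weyl_err N (k - 2) * real N ^ (k - 1)" if "p \<in> freqs k - {0}" for p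
    using norm_sum_cube_le[of N s "\<lambda>j. if j = Suc s then fst p else if j = 1 then snd p else 0" g] assms g that ge4
    unfolding phase_polyfun[of "k - 2" p, OF diff_le_mono[of 4 k 2, simplified, OF ge4]]
    by (simp add: s del: sum.atMost_Suc weyl_err.simps)
  have "complex_of_real (gowers_sum (k - 2) N (\<lambda>x. approximant N x - 1 / 2)) =
      (\<Sum>h\<in>{..<k - 2} \<rightarrow>\<^sub>E {..<N}. \<Sum>x<N. cube (k - 2) g g h x)"
    unfolding gowers_sum_eq_cube approximant_mod[OF N] of_real_sum cube_of_real[symmetric] g_def ..
  also have "\<dots> = (\<Sum>h\<in>{..<k - 2} \<rightarrow>\<^sub>E {..<N}. \<Sum>x<N. \<Sum>p\<in>freqs k - {0}. of_real (weight k \<epsilon> p) *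
      cube (k - 2) (\<lambda>x. e_mod N (phase (k - 2) p x)) g h x)"
    unfolding cube_sum[symmetric] by (simp only: g_def approximant_diff)
  also have "\<dots> = (\<Sum>h\<in>{..<k - 2} \<rightarrow>\<^sub>E {..<N}. \<Sum>p\<in>freqs k - {0}. \<Sum>x<N. of_real (weight k \<epsilon> p) *
      cube (k - 2) (\<lambda>x. e_mod N (phase (k - 2) p x)) g h x)"
    by (intro sum.cong refl sum.swap)
  also have "\<dots> = (\<Sum>p\<in>freqs k - {0}. of_real (weight k \<epsilon> p) *
      (\<Sum>h\<in>{..<k - 2} \<rightarrow>\<^sub>E {..<N}. \<Sum>x<N. cube (k - 2) (\<lambda>x. e_mod N (phase (k - 2) p x)) g h x))"
    by (subst sum.swap) (simp only: sum_distrib_left)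
  finally have "cmod (complex_of_real (gowers_sum (k - 2) N (\<lambda>x. approximant N x - 1 / 2)))
      \<le> (\<Sum>p\<in>freqs k - {0}. \<epsilon> * (weyl_err N (k - 2) * real N ^ (k - 1)))"
    using term_le \<epsilon>_pos by (simp only:) (intro sum_norm_le, auto simp: norm_mult abs_weight)
  also have "\<dots> \<le> (\<Sum>p\<in>freqs k. \<epsilon> * (weyl_err N (k - 2) * real N ^ (k - 1)))"
    using \<epsilon>_pos weyl_err_nonneg by (intro sum_mono2 finite_freqs) auto
  finally have "gowers_sum (k - 2) N (\<lambda>x. approximant N x - 1 / 2)
      \<le> card (freqs k) * \<epsilon> * weyl_err N (k - 2) * real N ^ (k - 1)"
    by (simp add: mult_ac norm_of_real)
  then show ?thesis
    using N by (simp add: pos_divide_le_eq)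
qed

lemma sum_approximant_le:
  assumes "prime N" "k < N" "\<And>p. p \<in> freqs k - {0} \<Longrightarrow> \<not> int N dvd fst p"
  shows "gowers_sum 1 N (\<lambda>x. approximant N x - 1 / 2) / real N ^ 2 \<le> (card (freqs k) * \<epsilon> * weyl_err N (k - 2))\<^sup>2"
proof -
  have s: "k - 2 \<ge> 2" "k - 2 < N" "k - 2 > 0"
    using ge4 assms by auto
  have term_le: "cmod (\<Sum>x<N. e_mod N (phase (k - 2) p x)) \<le> weyl_err N (k - 2) * real N" if "p \<in> freqs k - {0}" for p
    unfolding phase_polyfun[OF s(1)] using assms s that by (intro weyl_bound) auto
  have "complex_of_real (\<Sum>x<N. approximant N x - 1 / 2) =
      (\<Sum>p\<in>freqs k - {0}. of_real (weight k \<epsilon> p) * (\<Sum>x<N. e_mod N (phase (k - 2) p x)))"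
    unfolding of_real_sum approximant_diff sum_distrib_left by (rule sum.swap)
  then have "\<bar>\<Sum>x<N. approximant N x - 1 / 2\<bar> \<le> (\<Sum>p\<in>freqs k - {0}. \<epsilon> * (weyl_err N (k - 2) * real N))"
    using term_le \<epsilon>_pos unfolding norm_of_real[symmetric, where ?'a = complex]
    by (simp only:) (intro sum_norm_le, auto simp: norm_mult abs_weight)
  also have "\<dots> \<le> (\<Sum>p\<in>freqs k. \<epsilon> * (weyl_err N (k - 2) * real N))"
    using \<epsilon>_pos weyl_err_nonneg by (intro sum_mono2 finite_freqs) auto
  finally have "\<bar>\<Sum>x<N. approximant N x - 1 / 2\<bar> \<le> card (freqs k) * \<epsilon> * weyl_err N (k - 2) * real N"
    by (simp add: mult_ac)
  then have "(\<Sum>x<N. approximant N x - 1 / 2)\<^sup>2 \<le> (card (freqs k) * \<epsilon> * weyl_err N (k - 2) * real N)\<^sup>2"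
    by (rule abs_le_square_iff[THEN iffD1, OF order.trans]) simp
  then show ?thesis
    using assms unfolding gowers_sum_1 by (simp add: pos_divide_le_eq power_mult_distrib)
qed

text \<open>For fixed \<open>M\<close> all error terms vanish as \<open>N\<close> grows, however
  large \<open>M\<close> is; this leaves \<open>M\<close> free to tend to infinity along the final
  sequence.\<close>

lemma exists_uniform_set:
  assumes "M \<ge> 0" "\<delta> > 0"
  shows "\<forall>\<^sub>F N in primes_at_top. \<exists>A\<subseteq>{..<N}. ap_density k N A +
    M * (gowers_sum (k - 2) N (\<lambda>x. indicator A x - 1 / 2) / real N ^ (k - 1)
      + gowers_sum 1 N (\<lambda>x. indicator A x - 1 / 2) / real N ^ 2) \<le> limit_density k \<epsilon> + \<delta>"
proof -
  define E where "E = (\<lambda>N. card (freqs k) * \<epsilon> * weyl_err N (k - 2))"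
  define R where "R = (\<lambda>N. ap_sum k N (approximant N) / real N ^ 2 + M * (E N + (E N)\<^sup>2) + (1 + M * (2 * 4 ^ (k - 2) + 8)) / real N)"
  have w: "((\<lambda>N. weyl_err N (k - 2)) \<longlongrightarrow> 0) primes_at_top" "((\<lambda>N. c / real N) \<longlongrightarrow> 0) primes_at_top" for c
    by (rule tendsto_mono[OF primes_at_top_le], rule weyl_err_tendsto lim_const_over_n)+
  have "(E \<longlongrightarrow> card (freqs k) * \<epsilon> * 0) primes_at_top"
    unfolding E_def by (intro tendsto_mult_left w)
  then have "(R \<longlongrightarrow> limit_density k \<epsilon> + M * (0 + 0\<^sup>2) + 0) primes_at_top"
    unfolding R_def by (intro tendsto_add tendsto_mult_left tendsto_power ap_sum_tendsto w) simp_all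
  then have "\<forall>\<^sub>F N in primes_at_top. R N < limit_density k \<epsilon> + \<delta>"
    by (rule order_tendstoD) (use assms in simp)
  with eventually_fst_freqs show ?thesis
  proof eventually_elim
    case (elim N)
    have b: "0 \<le> approximant N x \<and> approximant N x \<le> 1" for x
      using approximant_bounds[of N x] by linarith
    have pr: "prime N" and half: "(0 :: real) \<le> 1 / 2" "(1 / 2 :: real) \<le> 1"
      using elim by auto
    have k: "k - 2 + 1 = k - 1" "k - 2 > 0" "k \<le> N"
      using ge4 elim by auto
    obtain A where A: "A \<subseteq> {..<N}" "ap_density k N A +
        M * (gowers_sum (k - 2) N (\<lambda>x. indicator A x - 1 / 2) / real N ^ (k - 1)
          + gowers_sum 1 N (\<lambda>x. indicator A x - 1 / 2) / real N ^ 2)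
      \<le> ap_sum k N (approximant N) / real N ^ 2 +
        M * (gowers_sum (k - 2) N (\<lambda>x. approximant N x - 1 / 2) / real N ^ (k - 1)
          + gowers_sum 1 N (\<lambda>x. approximant N x - 1 / 2) / real N ^ 2)
        + (1 + M * (2 * 4 ^ (k - 2) + 8)) / real N"
      using exists_rounded_set[where f = "approximant N", OF pr k(3,2) assms(1) b half, unfolded k(1)] by (elim exE conjE) (rule that)
    note A(2)
    also have "\<dots> \<le> R N"
      unfolding R_def E_def using elim assms(1)
      by (intro add_mono mult_left_mono gowers_sum_approximant_le sum_approximant_le) auto
    finally show ?case
      using A(1) elim by (intro exI[of _ A]) auto
  qed
qed

end

text \<open>The sets are compared with the constant \<open>1 / 2\<close>, whereas uniformity
  subtracts their own density; this bounds the cost of the exchange. The products telescope, each of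
  the \<open>2 ^ s\<close> factors costing at most \<open>\<eta>\<close>.\<close>

lemma gowers_sum_diff_le:
  assumes "N > 0" "\<And>x. x < N \<Longrightarrow> \<bar>f x\<bar> \<le> 1" "\<And>x. x < N \<Longrightarrow> \<bar>g x\<bar> \<le> 1" "\<And>x. x < N \<Longrightarrow> \<bar>f x - g x\<bar> \<le> \<eta>"
  shows "\<bar>gowers_sum s N f - gowers_sum s N g\<bar> \<le> 2 ^ s * \<eta> * real N ^ (s + 1)"
proof -
  let ?\<Omega> = "{..<s} \<rightarrow>\<^sub>E {0, 1 :: nat}" and ?H = "{..<s} \<rightarrow>\<^sub>E {..<N}"
  have c: "card ?\<Omega> = 2 ^ s" "card ?H = N ^ s"
    by (simp_all add: card_PiE numeral_2_eq_2)
  have "\<bar>(\<Prod>\<omega>\<in>?\<Omega>. f ((x + (\<Sum>i<s. \<omega> i * h i)) mod N)) - (\<Prod>\<omega>\<in>?\<Omega>. g ((x + (\<Sum>i<s. \<omega> i * h i)) mod N))\<bar>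
      \<le> (\<Sum>\<omega>\<in>?\<Omega>. \<bar>f ((x + (\<Sum>i<s. \<omega> i * h i)) mod N) - g ((x + (\<Sum>i<s. \<omega> i * h i)) mod N)\<bar>)" for x h
    using assms norm_prod_diff[of ?\<Omega> "\<lambda>\<omega>. f ((x + (\<Sum>i<s. \<omega> i * h i)) mod N)" "\<lambda>\<omega>. g ((x + (\<Sum>i<s. \<omega> i * h i)) mod N)"]
    by simp
  also have "(\<Sum>\<omega>\<in>?\<Omega>. \<bar>f ((x + (\<Sum>i<s. \<omega> i * h i)) mod N) - g ((x + (\<Sum>i<s. \<omega> i * h i)) mod N)\<bar>) \<le> (\<Sum>\<omega>\<in>?\<Omega>. \<eta>)" for x h
    using assms by (intro sum_mono) simp
  finally have le: "\<bar>(\<Prod>\<omega>\<in>?\<Omega>. f ((x + (\<Sum>i<s. \<omega> i * h i)) mod N)) - (\<Prod>\<omega>\<in>?\<Omega>. g ((x + (\<Sum>i<s. \<omega> i * h i)) mod N))\<bar>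
      \<le> 2 ^ s * \<eta>" for x h
    using c by simp
  have "\<bar>gowers_sum s N f - gowers_sum s N g\<bar> \<le> (\<Sum>x<N. \<Sum>h\<in>?H. 2 ^ s * \<eta>)"
    unfolding gowers_sum_def sum_subtractf[symmetric]
    by (intro order.trans[OF sum_abs] sum_mono le)
  then show ?thesis
    by (simp add: c mult_ac)
qed

theorem corollary1p5:
  fixes k :: nat
  assumes "even k" and "k \<ge> 4"
  shows "\<exists>\<alpha>::real. 0 < \<alpha> \<and> \<alpha> < 1 \<and> rho k \<alpha> < ereal (\<alpha> ^ k)"
proof -
  define s where "s = k - 2"
  have s: "s > 0" "k - 1 = s + 1" "k - 2 = s"
    using assms by (auto simp: s_def)
  define \<epsilon> where "\<epsilon> = 1 / (2 * real (card (freqs k)))"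
  define L where "L = limit_density k \<epsilon>"
  have "\<epsilon> > 0"
    unfolding \<epsilon>_def using \<epsilon>_pos[OF assms] .
  then have L: "L < (1 / 2) ^ k"
    using limit_density_le[OF assms, of \<epsilon>] zero_less_power[of \<epsilon> k] unfolding L_def by linarith
  have "L \<le> 1"
    using L power_le_one[of "1 / 2 :: real" k] by simp
  define Gs where "Gs = (\<lambda>N A. gowers_sum s N (\<lambda>x. indicator A x - 1 / 2) / real N ^ (s + 1))"
  define G1 where "G1 = (\<lambda>N A. gowers_sum 1 N (\<lambda>x. indicator A x - 1 / 2) / real N ^ 2)"
  \<comment> \<open>Diagonal choice: the penalty \<open>M = Suc j\<close> grows while the tolerance
    \<open>1 / Suc j\<close> shrinks, and \<open>N\<close> is taken large in terms of
    \<open>j\<close>.\<close>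
  have "\<exists>N A. prime N \<and> j \<le> N \<and> A \<subseteq> {..<N} \<and>
      ap_density k N A + real (Suc j) * (Gs N A + G1 N A) \<le> L + 1 / real (Suc j)" for j
  proof -
    have "0 \<le> real (Suc j)" "0 < 1 / real (Suc j)"
      by simp_all
    from exists_uniform_set[OF assms this]
    have "\<forall>\<^sub>F N in primes_at_top. \<exists>A\<subseteq>{..<N}. ap_density k N A + real (Suc j) * (Gs N A + G1 N A) \<le> L + 1 / real (Suc j)"
      unfolding Gs_def G1_def L_def \<epsilon>_def s(2,3) .
    then obtain N0 where N0: "\<And>N. N \<ge> N0 \<Longrightarrow> prime N \<Longrightarrow>
        \<exists>A\<subseteq>{..<N}. ap_density k N A + real (Suc j) * (Gs N A + G1 N A) \<le> L + 1 / real (Suc j)"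
      unfolding eventually_primes_at_top by blast
    obtain N where "prime N" "N > max N0 j"
      using bigger_prime by blast
    then show ?thesis
      using N0[of N] by (intro exI[of _ N]) auto
  qed
  then obtain N A where prime: "\<And>j. prime (N j)" and N_ge: "\<And>j. j \<le> N j" and A: "\<And>j. A j \<subseteq> {..<N j}"
    and bound: "\<And>j. ap_density k (N j) (A j) + real (Suc j) * (Gs (N j) (A j) + G1 (N j) (A j)) \<le> L + 1 / real (Suc j)"
    by metis
  have N: "N j > 0" for j
    using prime prime_gt_0_nat by blast
  have nonneg: "0 \<le> ap_density k (N j) (A j)" "0 \<le> Gs (N j) (A j)" "0 \<le> G1 (N j) (A j)" for j
    using s by (simp_all add: ap_density_def Gs_def G1_def gowers_sum_nonneg del: One_nat_def)
  \<comment> \<open>Dropping the nonnegative progression density leaves at most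
    \<open>L + 1 \<le> 2\<close> on the right, so the growing penalty forces both Gowers averages to
    0.\<close>
  have small: "Gs (N j) (A j) + G1 (N j) (A j) \<le> 2 / real (Suc j)" for j
  proof -
    have "real (Suc j) * (Gs (N j) (A j) + G1 (N j) (A j)) \<le> L + 1 / real (Suc j)"
      using bound[of j] nonneg(1)[of j] by linarith
    also have "\<dots> \<le> 2"
    proof -
      have "1 / real (Suc j) \<le> 1"
        by simp
      then show ?thesis
        using \<open>L \<le> 1\<close> by linarith
    qed
    finally show ?thesis
      by (simp add: field_simps)
  qed
  have lim0: "(\<lambda>j. 2 / real (Suc j)) \<longlonglongrightarrow> 0"
    using LIMSEQ_Suc[OF lim_const_over_n[of "2 :: real"]] by simp
  have abs: "\<bar>Gs (N j) (A j)\<bar> \<le> 2 / real (Suc j)" "\<bar>G1 (N j) (A j)\<bar> \<le> 2 / real (Suc j)" for j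
    using small[of j] nonneg(2,3)[of j] by linarith+
  have "\<forall>\<^sub>F j in sequentially. norm (Gs (N j) (A j)) \<le> 2 / real (Suc j)"
    "\<forall>\<^sub>F j in sequentially. norm (G1 (N j) (A j)) \<le> 2 / real (Suc j)"
    unfolding real_norm_def by (intro always_eventually allI abs)+
  note lim = this[THEN Lim_null_comparison, OF lim0]
  define dens where "dens = (\<lambda>j. real (card (A j)) / real (N j))"
  \<comment> \<open>The \<open>U^1\<close> average is the squared deviation of the density, so its
    decay yields the density condition.\<close>
  have "G1 (N j) (A j) = (dens j - 1 / 2)\<^sup>2" for j
  proof -
    have "(\<Sum>x<N j. indicator (A j) x) = real (card (A j))"
      using A[of j] by (simp add: indicator_def Int_absorb1)
    then have sum_eq: "(\<Sum>x<N j. indicator (A j) x - 1 / 2) = real (card (A j)) - real (N j) / 2"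
      by (simp add: sum_subtractf)
    show ?thesis
      using N[of j] unfolding G1_def gowers_sum_1 dens_def sum_eq power_divide[symmetric]
      by (simp add: diff_divide_distrib)
  qed
  then have "(\<lambda>j. sqrt ((dens j - 1 / 2)\<^sup>2)) \<longlonglongrightarrow> 0"
    using tendsto_real_sqrt[OF lim(2)] by simp
  then have lim_abs: "(\<lambda>j. \<bar>dens j - 1 / 2\<bar>) \<longlonglongrightarrow> 0"
    by simp
  then have dens: "dens \<longlonglongrightarrow> 1 / 2"
    by (simp add: tendsto_rabs_zero_iff LIM_zero_iff)
  have dens_bounds: "0 \<le> dens j" "dens j \<le> 1" for j
    using card_mono[OF _ A[of j]] N[of j] by (auto simp: dens_def)
  have diff: "\<bar>gowers_sum s (N j) (\<lambda>x. indicator (A j) x - dens j) / real (N j) ^ (s + 1) - Gs (N j) (A j)\<bar>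
      \<le> 2 ^ s * \<bar>dens j - 1 / 2\<bar>" for j
  proof -
    have "\<bar>gowers_sum s (N j) (\<lambda>x. indicator (A j) x - dens j) - gowers_sum s (N j) (\<lambda>x. indicator (A j) x - 1 / 2)\<bar>
        \<le> 2 ^ s * \<bar>dens j - 1 / 2\<bar> * real (N j) ^ (s + 1)"
      using dens_bounds[of j] N[of j] by (intro gowers_sum_diff_le) (auto simp: indicator_def)
    then have "\<bar>gowers_sum s (N j) (\<lambda>x. indicator (A j) x - dens j) - gowers_sum s (N j) (\<lambda>x. indicator (A j) x - 1 / 2)\<bar>
        / real (N j) ^ (s + 1) \<le> 2 ^ s * \<bar>dens j - 1 / 2\<bar>"
      using N[of j] by (subst pos_divide_le_eq) auto
    then show ?thesis
      unfolding Gs_def by (simp add: abs_divide flip: diff_divide_distrib)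
  qed
  have lim_diff: "(\<lambda>j. 2 ^ s * \<bar>dens j - 1 / 2\<bar>) \<longlonglongrightarrow> 0"
    using tendsto_mult_left[OF lim_abs, of "2 ^ s"] by simp
  have "\<forall>\<^sub>F j in sequentially. norm (gowers_sum s (N j) (\<lambda>x. indicator (A j) x - dens j) / real (N j) ^ (s + 1) - Gs (N j) (A j))
      \<le> 2 ^ s * \<bar>dens j - 1 / 2\<bar>"
    unfolding real_norm_def by (intro always_eventually allI diff)
  then have "(\<lambda>j. gowers_sum s (N j) (\<lambda>x. indicator (A j) x - dens j) / real (N j) ^ (s + 1) - Gs (N j) (A j)) \<longlonglongrightarrow> 0"
    using lim_diff by (rule Lim_null_comparison)
  from tendsto_add[OF this lim(1)]
  have "(\<lambda>j. gowers_sum s (N j) (\<lambda>x. indicator (A j) x - dens j) / real (N j) ^ (s + 1)) \<longlonglongrightarrow> 0"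
    by simp
  from tendsto_real_root[OF this, of "2 ^ s"]
  have "(\<lambda>j. gowers_norm s (N j) (\<lambda>x. indicator (A j) x - dens j)) \<longlonglongrightarrow> 0"
    by (simp add: gowers_norm_eq)
  moreover have "filterlim N at_top sequentially"
    by (rule filterlim_at_top_mono[OF filterlim_ident]) (simp add: N_ge)
  ultimately have "uniform_sequence (k - 2) N A"
    using prime A by (simp add: uniform_sequence_def s_def dens_def)
  then have "rho k (1 / 2) \<le> liminf (\<lambda>j. ereal (ap_density k (N j) (A j)))"
    unfolding rho_def using dens by (intro Inf_lower) (auto simp: dens_def)
  also have "\<dots> \<le> liminf (\<lambda>j. ereal (L + 1 / real (Suc j)))"
  \<comment> \<open>The same inequality is used a second time, now dropping the nonnegative Gowers
    averages.\<close>
  proof (intro Liminf_mono always_eventually allI)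
    fix j
    have "0 \<le> real (Suc j) * (Gs (N j) (A j) + G1 (N j) (A j))"
      using nonneg by simp
    then show "ereal (ap_density k (N j) (A j)) \<le> ereal (L + 1 / real (Suc j))"
      using bound[of j] by simp
  qed
  also have "\<dots> = ereal L"
  proof (rule lim_imp_Liminf)
    have "(\<lambda>j. L + 1 / real (Suc j)) \<longlonglongrightarrow> L + 0"
      using LIMSEQ_Suc[OF lim_const_over_n[of "1 :: real"]] by (intro tendsto_intros) simp
    then show "(\<lambda>j. ereal (L + 1 / real (Suc j))) \<longlonglongrightarrow> ereal L"
      by simp
  qed simp
  also have "\<dots> < ereal ((1 / 2) ^ k)"
    using L by simp
  finally show ?thesis
    by (intro exI[of _ "1 / 2"]) auto
qed

end
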